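(* Let $\{X_t\}_{t\in\mathbb Z}$ be a stationary process with distribution $P$ and values in a finite set $\mathcal X$ (with $|\mathcal X|\ge2$). Let $\hat P(x\mid X^{-n})$ be the truncated conditional probability mass function estimates defined in the context, with default measure $Q(x)=|\mathcal X|^{-1}$. If the block length $k(n)$ and the sample size $J_{k(n)}$ are monotonically increasing (nondecreasing) to infinity and satisfy $$J_{k(n)}\,|\mathcal X|^{k(n)}=O(n),$$ then the estimates are consistent in mean: for every $x\in\mathcal X$, $$\hat P(x\mid X^{-n})\to P(x\mid X^-)\quad\text{in }L^1(P)\text{ as }n\to\infty.$$ In particular, for any $0<\varepsilon<1$, the estimates are consistent in mean if the block length is $k(n)=(1-\varepsilon)\log_{|\mathcal X|}n$ and the sample size is $J_{k(n)}=n^\varepsilon$, up to rounding down to integers; that is, with $J_k=\lfloor|\mathcal X|^{k\varepsilon/(1-\varepsilon)}\rfloor$ for $k\ge1$ and $k(n)=\max\{1,\lfloor(1-\varepsilon)\log_{|\mathcal X|}n\rfloor\}$.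
   Context: Notation: $X=X_0$; $X^-=(\ldots,X_{-2},X_{-1})$; $X^{-n}=(X_{-n},\ldots,X_{-1})$; $P(x\mid X^-)=P\{X_0=x\mid X^-\}$. Let $\{J_k\}_{k\ge1}$ be a nondecreasing sequence of positive integers and $k(n)$ a sequence of positive integers. The past recurrence times of the block $X^{-k}$ are $\tau^k_0=0$ and, for $j\ge1$, $$\tau^k_j=\inf\{t>\tau^k_{j-1}:\ (X_{-k-t},\ldots,X_{-1-t})=(X_{-k},\ldots,X_{-1})\}.$$ Put $\lambda(k)=k+\tau^k_{J_k}$ and $$\hat P_k(x\mid X^{-\lambda(k)})=\frac1{J_k}\sum_{1\le j\le J_k}1\{X_{-\tau^k_j}=x\}.$$ The truncated estimates are $$\hat P(x\mid X^{-n})=\begin{cases}\hat P_{k(n)}(x\mid X^{-\lambda(k(n))})&\text{if }\lambda(k(n))\le n,\\ Q(x)&\text{otherwise.}\end{cases}$$ *)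

theory Defs
  imports "HOL-Probability.Probability" "HOL-Library.Landau_Symbols"
begin

definition stationary_process :: "'w measure \<Rightarrow> 'a measure \<Rightarrow> (int \<Rightarrow> 'w \<Rightarrow> 'a) \<Rightarrow> bool" where
  "stationary_process M N X \<longleftrightarrow>
     (\<forall>t. X t \<in> measurable M N) \<and>
     (\<forall>s. distr M (\<Pi>\<^sub>M t\<in>UNIV. N) (\<lambda>\<omega> t. X (t + s) \<omega>) =
          distr M (\<Pi>\<^sub>M t\<in>UNIV. N) (\<lambda>\<omega> t. X t \<omega>))"

definition past_algebra :: "'w measure \<Rightarrow> 'a measure \<Rightarrow> (int \<Rightarrow> 'w \<Rightarrow> 'a) \<Rightarrow> 'w measure" where
  "past_algebra M N X =
     sigma (space M) {X t -` A \<inter> space M | t A. t < 0 \<and> A \<in> sets N}"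

definition past_cond_prob ::
    "'w measure \<Rightarrow> 'a measure \<Rightarrow> (int \<Rightarrow> 'w \<Rightarrow> 'a) \<Rightarrow> 'a \<Rightarrow> 'w \<Rightarrow> real" where
  "past_cond_prob M N X x =
     real_cond_exp M (past_algebra M N X) (indicator {\<omega> \<in> space M. X 0 \<omega> = x})"

text \<open>
  In the following definitions, \<open>w\<close> is a single two-sided sample path.  Recurrence times are
  extended naturals, so that a block that recurs fewer than \<open>j\<close> times in the past has
  \<open>j\<close>-th recurrence time \<open>\<infinity>\<close> (the infimum of the empty set).
\<close>

fun recurrence_time :: "(int \<Rightarrow> 'a) \<Rightarrow> nat \<Rightarrow> nat \<Rightarrow> enat" where
  "recurrence_time w k 0 = 0"
| "recurrence_time w k (Suc j) =
     Inf {enat t | t. recurrence_time w k j < enat t \<and>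
            map w [- int k - int t..- 1 - int t] = map w [- int k..- 1]}"

definition past_length :: "(nat \<Rightarrow> nat) \<Rightarrow> (int \<Rightarrow> 'a) \<Rightarrow> nat \<Rightarrow> enat" where
  "past_length J w k = enat k + recurrence_time w k (J k)"

text \<open>
  The next definition is meaningful only if \<open>past_length J w k < \<infinity>\<close>; then the first \<open>J k\<close>
  recurrence times are all finite.  Its value on other paths is never used below.
\<close>

definition block_estimate :: "(nat \<Rightarrow> nat) \<Rightarrow> (int \<Rightarrow> 'a) \<Rightarrow> nat \<Rightarrow> 'a \<Rightarrow> real" where
  "block_estimate J w k x =
     (1 / real (J k)) *
     (\<Sum>j = 1..J k. if w (- int (the_enat (recurrence_time w k j))) = x then 1 else 0)"

definition truncated_estimate ::
    "(nat \<Rightarrow> nat) \<Rightarrow> (nat \<Rightarrow> nat) \<Rightarrow> ('a \<Rightarrow> real) \<Rightarrow> (int \<Rightarrow> 'a) \<Rightarrow> nat \<Rightarrow> 'a \<Rightarrow> real" where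
  "truncated_estimate J k Q w n x =
     (if past_length J w (k n) \<le> enat n then block_estimate J w (k n) x else Q x)"

definition tendsto_L1 :: "'w measure \<Rightarrow> (nat \<Rightarrow> 'w \<Rightarrow> real) \<Rightarrow> ('w \<Rightarrow> real) \<Rightarrow> bool" where
  "tendsto_L1 M f g \<longleftrightarrow>
     (\<forall>n. integrable M (f n)) \<and> integrable M g \<and>
     (\<lambda>n. \<integral>\<omega>. \<bar>f n \<omega> - g \<omega>\<bar> \<partial>M) \<longlonglongrightarrow> 0"

definition consistent_in_mean ::
    "'w measure \<Rightarrow> 'a set \<Rightarrow> (int \<Rightarrow> 'w \<Rightarrow> 'a) \<Rightarrow> (nat \<Rightarrow> nat) \<Rightarrow> (nat \<Rightarrow> nat) \<Rightarrow> bool" where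
  "consistent_in_mean M S X J k \<longleftrightarrow>
     (\<forall>x\<in>S. tendsto_L1 M
        (\<lambda>n \<omega>. truncated_estimate J k (\<lambda>_. 1 / real (card S)) (\<lambda>t. X t \<omega>) n x)
        (past_cond_prob M (count_space S) X x))"

end

theory Submission
  imports Defs
begin

text \<open>
  Write \<open>b\<close> for the block of the last \<open>k\<close> symbols, \<open>p\<^sub>k(x)\<close> for the conditional probability of
  \<open>X\<^sub>0 = x\<close> given \<open>b\<close>, and \<open>p(x)\<close> for the conditional probability given the whole past.  The error
  of the truncated estimate is at most the sum of three terms: \<open>|p - p\<^sub>k|\<close>, the error
  \<open>|P\<^sub>k - p\<^sub>k|\<close> of the empirical frequency \<open>P\<^sub>k\<close> of \<open>x\<close> after the first \<open>J\<close> recurrences, and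
  \<open>|Q - p\<^sub>k|\<close> on the event that these recurrences do not fit into the sample.

  The expectation \<open>\<gamma>\<^sub>k\<close> of the first term tends to 0 because every integrable function of the past is
  an \<open>L\<^sup>1\<close>-limit of functions of finitely many coordinates, and averaging over blocks contracts
  \<open>L\<^sup>1\<close> (\<open>past_gap_tendsto_0\<close>).

  For the second term, moving the origin of time back to the \<open>i\<close>-th recurrence of \<open>b\<close> preserves the
  law of the process (\<open>expectation_at_recurrence\<close>), and it does not change the current block.  So the
  correlation of the sampling errors at recurrences \<open>i\<close> and \<open>i + l\<close> equals that of the errors at time
  0 and at recurrence \<open>l\<close>.  The latter is a function of the past, so the former error may be replaced
  by \<open>p - p\<^sub>k\<close>; hence the correlation is at most \<open>\<gamma>\<^sub>k\<close> and the mean square of \<open>P\<^sub>k - p\<^sub>k\<close> is at most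
  \<open>1/J + \<gamma>\<^sub>k\<close>.

  The third term does not vanish because recurrences come early: if \<open>J |S|\<^sup>k\<close> is only \<open>O(n)\<close>, they
  may well be too late, for instance when the process is a sequence of fair independent draws.  But
  then the uniform default is right.  By stationarity, a block \<open>b\<close> of probability \<open>P(b)\<close> is current
  and recurs too late with probability at most \<open>J/(n - k + 1)\<close>, which is of order \<open>|S|\<^sup>-\<^sup>k\<close>; it is also at
  most \<open>P(b)\<close>, hence at most a constant times the geometric mean \<open>sqrt (P(b) |S|\<^sup>-\<^sup>k)\<close>.  The sum
  \<open>H\<^sub>k\<close> of these means over all blocks is the Hellinger affinity between the law of a block and the
  uniform law.  It is nonincreasing in \<open>k\<close>, so \<open>H\<^sub>k - H\<^sub>k\<^sub>+\<^sub>1\<close> tends to 0; and this difference bounds the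
  sum of \<open>sqrt (P(b) |S|\<^sup>-\<^sup>k) |Q - p\<^sub>k|\<^sup>2\<close> up to a factor of 8
  (\<open>sum_weighted_square_deviation_le\<close>).  By Cauchy-Schwarz the expectation of the third term, which
  carries \<open>|Q - p\<^sub>k|\<close> in place of its square, tends to 0 as well.
\<close>

section \<open>Sample paths\<close>

definition block :: "nat \<Rightarrow> (int \<Rightarrow> 'a) \<Rightarrow> int \<Rightarrow> 'a list" where
  "block k w t = map w [t - int k..t - 1]"

definition path_shift :: "int \<Rightarrow> (int \<Rightarrow> 'a) \<Rightarrow> int \<Rightarrow> 'a" where
  "path_shift s w = (\<lambda>t. w (t + s))"

definition visits :: "nat \<Rightarrow> (int \<Rightarrow> 'a) \<Rightarrow> 'a list \<Rightarrow> int set \<Rightarrow> nat" where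
  "visits k w b I = card {t \<in> I. block k w t = b}"

lemma length_block [simp]: "length (block k w t) = k"
  by (simp add: block_def)

lemma set_block: "set (block k w t) = w ` {t - int k..t - 1}"
  by (simp add: block_def)

lemma block_cong:
  "(\<And>r. t - int k \<le> r \<Longrightarrow> r < t \<Longrightarrow> w r = w' r) \<Longrightarrow> block k w t = block k w' t"
  by (auto simp: block_def)

lemma nth_block: "i < k \<Longrightarrow> block k w t ! i = w (t - int k + int i)"
  by (simp add: block_def)

lemma block_shift [simp]: "block k (path_shift s w) t = block k w (t + s)"
  by (rule nth_equalityI) (simp_all add: nth_block path_shift_def algebra_simps)

lemma block_snoc: "block (Suc k) w (t + 1) = block k w t @ [w t]"
  by (rule nth_equalityI) (auto simp: nth_block nth_append less_Suc_eq)

lemma drop_block: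
  assumes "k \<le> m"
  shows "drop (m - k) (block m w t) = block k w t"
  by (rule nth_equalityI) (use assms in \<open>auto simp: nth_block of_nat_diff algebra_simps\<close>)

lemma visits_shift: "visits k (path_shift s w) b I = visits k w b ((\<lambda>t. t + s) ` I)"
proof -
  have "{t \<in> (\<lambda>t. t + s) ` I. block k w t = b} = (\<lambda>t. t + s) ` {t \<in> I. block k w (t + s) = b}"
    by auto
  then show ?thesis
    by (simp add: visits_def card_image)
qed

lemma visits_shift_atLeastLessThan:
  "visits k (path_shift s w) b {u..<v} = visits k w b {u + s..<v + s}"
  by (simp add: visits_shift)

lemma visits_split:
  assumes "u \<le> v" "v \<le> r"
  shows "visits k w b {u..<r} = visits k w b {u..<v} + visits k w b {v..<r}"
proof -
  have "{t \<in> {u..<r}. block k w t = b} =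
        {t \<in> {u..<v}. block k w t = b} \<union> {t \<in> {v..<r}. block k w t = b}"
    using assms by auto
  moreover have "card ({t \<in> {u..<v}. block k w t = b} \<union> {t \<in> {v..<r}. block k w t = b}) =
      card {t \<in> {u..<v}. block k w t = b} + card {t \<in> {v..<r}. block k w t = b}"
  proof (rule card_Un_disjoint)
    show "finite {t \<in> {u..<v}. block k w t = b}" "finite {t \<in> {v..<r}. block k w t = b}"
      by (rule finite_subset[of _ "{u..<v}"], blast, simp)
        (rule finite_subset[of _ "{v..<r}"], blast, simp)
  qed auto
  ultimately show ?thesis
    by (simp only: visits_def)
qed

lemma visits_singleton: "visits k w b {t..<t + 1} = (if block k w t = b then 1 else 0)"
proof -
  have "{s \<in> {t..<t + 1}. block k w s = b} = (if block k w t = b then {t} else {})"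
    by auto
  then show ?thesis by (simp add: visits_def)
qed

lemma visits_Suc:
  "visits k w b {- int (Suc t)..<0} =
   visits k w b {- int t..<0} + (if block k w (- int (Suc t)) = b then 1 else 0)"
  using visits_split[of "- int (Suc t)" "- int t" 0 k w b] visits_singleton[of k w b "- int (Suc t)"]
  by simp

lemma recurrence_time_Suc:
  "recurrence_time w k (Suc j) =
   Inf {enat t | t. recurrence_time w k j < enat t \<and> block k w (- int t) = block k w 0}"
proof -
  have *: "map w [- int k - int t..- 1 - int t] = block k w (- int t)" for t
    by (rule nth_equalityI) (simp_all add: nth_block algebra_simps)
  have "map w [- int k..- 1] = block k w 0"
    by (simp add: block_def)
  then show ?thesis
    by (simp add: *)
qed

lemma Inf_enat_le_iff: "Inf {enat t | t. P t} \<le> enat n \<longleftrightarrow> (\<exists>t\<le>n. P t)"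
proof
  assume le: "Inf {enat t | t. P t} \<le> enat n"
  then have ne: "{enat t | t. P t} \<noteq> {}"
    by (intro notI) (simp add: Inf_enat_def)
  then have "Inf {enat t | t. P t} \<in> {enat t | t. P t}"
    unfolding Inf_enat_def by (auto intro: LeastI)
  then show "\<exists>t\<le>n. P t"
    using le by (auto)
next
  assume "\<exists>t\<le>n. P t"
  then obtain t where "t \<le> n" "P t" by auto
  then show "Inf {enat t | t. P t} \<le> enat n"
    by (intro order_trans[OF Inf_lower[of "enat t"]]) auto
qed

text \<open>
  The recursive infimum is turned into a count: \<open>j\<close> recurrences happen within \<open>n\<close> steps exactly when
  the current block occurs at least \<open>j\<close> times at the positions \<open>-n, \<dots>, -1\<close>.  Counts are easy to
  shift, to add and to measure.
\<close>

lemma recurrence_time_le_iff: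
  "recurrence_time w k j \<le> enat n \<longleftrightarrow> j \<le> visits k w (block k w 0) {- int n..<0}"
proof (induction j arbitrary: n)
  case 0
  then show ?case by (simp add: zero_enat_def)
next
  case (Suc j)
  let ?v = "\<lambda>n. visits k w (block k w 0) {- int n..<0}"
  have lt: "recurrence_time w k j < enat (Suc t) \<longleftrightarrow> j \<le> ?v t" for t
    using Suc.IH[of t] by (cases "recurrence_time w k j") auto
  have "recurrence_time w k (Suc j) \<le> enat n \<longleftrightarrow>
        (\<exists>t\<le>n. recurrence_time w k j < enat t \<and> block k w (- int t) = block k w 0)"
    unfolding recurrence_time_Suc by (rule Inf_enat_le_iff)
  also have "\<dots> \<longleftrightarrow> Suc j \<le> ?v n"
  proof (induction n)
    case 0
    then show ?case by (simp add: visits_def flip: zero_enat_def)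
  next
    case (Suc n)
    show ?case
      unfolding le_Suc_eq[of _ n] visits_Suc
      using Suc.IH lt[of n]
      by (auto simp: conj_disj_distribR ex_disj_distrib simp del: of_nat_Suc split: if_splits)
  qed
  finally show ?case .
qed

lemma recurrence_time_eq_iff:
  "recurrence_time w k j = enat n \<longleftrightarrow>
   block k w (- int n) = block k w 0 \<and> visits k w (block k w 0) {- int n..<0} = j"
proof (cases n)
  case 0
  have "recurrence_time w k j = enat 0 \<longleftrightarrow> recurrence_time w k j \<le> enat 0"
    by (simp flip: zero_enat_def)
  then show ?thesis
    unfolding recurrence_time_le_iff using 0 by (auto simp: visits_def)
next
  case (Suc m)
  have "recurrence_time w k j = enat n \<longleftrightarrow>
        recurrence_time w k j \<le> enat n \<and> \<not> recurrence_time w k j \<le> enat m"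
    unfolding Suc by (cases "recurrence_time w k j") auto
  then show ?thesis
    unfolding recurrence_time_le_iff unfolding Suc visits_Suc
    by (auto simp del: of_nat_Suc split: if_splits)
qed

lemma enat_eqI: "(\<And>n. a \<le> enat n \<longleftrightarrow> b \<le> enat n) \<Longrightarrow> a = b"
  by (metis dual_order.refl enat_ord_code(3) not_enat_eq order_antisym)

text \<open>
  Recurrence times are additive along the path: seen from the \<open>i\<close>-th recurrence, the later recurrences
  of the original block are the recurrences of the block that is current there, since the two blocks
  agree.
\<close>

lemma recurrence_time_add:
  assumes "recurrence_time w k i = enat s"
  shows "recurrence_time w k (i + l) = enat s + recurrence_time (path_shift (- int s) w) k l"
proof (rule enat_eqI)
  fix n
  let ?b = "block k w 0"
  from assms have b: "block k w (- int s) = ?b" and v: "visits k w ?b {- int s..<0} = i"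
    by (simp_all add: recurrence_time_eq_iff)
  show "recurrence_time w k (i + l) \<le> enat n \<longleftrightarrow>
        enat s + recurrence_time (path_shift (- int s) w) k l \<le> enat n"
  proof (cases "s \<le> n")
    case True
    have "enat s + recurrence_time (path_shift (- int s) w) k l \<le> enat n \<longleftrightarrow>
          recurrence_time (path_shift (- int s) w) k l \<le> enat (n - s)"
      using True by (cases "recurrence_time (path_shift (- int s) w) k l") auto
    also have "\<dots> \<longleftrightarrow> l \<le> visits k w ?b {- int n..<- int s}"
      using True by (simp add: recurrence_time_le_iff visits_shift_atLeastLessThan b of_nat_diff)
    also have "\<dots> \<longleftrightarrow> i + l \<le> visits k w ?b {- int n..<0}"
      using visits_split[of "- int n" "- int s" 0 k w ?b] True v by simp
    finally show ?thesis
      by (simp add: recurrence_time_le_iff)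
  next
    case False
    then have "visits k w ?b {- int s..<0} =
        visits k w ?b {- int s..<- int s + 1} + visits k w ?b {- int s + 1..<0}"
      by (intro visits_split) auto
    moreover have "visits k w ?b {- int s + 1..<0} =
        visits k w ?b {- int s + 1..<- int n} + visits k w ?b {- int n..<0}"
      using False by (intro visits_split) auto
    ultimately have "visits k w ?b {- int n..<0} < i"
      using v b visits_singleton[of k w ?b "- int s"] by simp
    then have "\<not> recurrence_time w k (i + l) \<le> enat n"
      by (simp add: recurrence_time_le_iff)
    moreover have "\<not> enat s + recurrence_time (path_shift (- int s) w) k l \<le> enat n"
      using False by (cases "recurrence_time (path_shift (- int s) w) k l") auto
    ultimately show ?thesis by simp
  qed
qed

text \<open>
  Seen from time \<open>-s\<close>, the condition that \<open>s\<close> is the \<open>i\<close>-th recurrence time becomes a statement about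
  the future: the block at time \<open>0\<close> comes back at time \<open>s\<close>, with \<open>i\<close> occurrences in \<open>{0..<s}\<close>.  For
  a fixed \<open>i\<close> only one \<open>s\<close> can satisfy it.
\<close>

lemma recurrence_time_shift_eq_iff:
  "recurrence_time (path_shift (int s) w) k i = enat s \<longleftrightarrow>
   block k w (int s) = block k w 0 \<and> visits k w (block k w 0) {0..<int s} = i"
  by (auto simp: recurrence_time_eq_iff visits_shift_atLeastLessThan)

lemma recurrence_time_shift_inj:
  assumes "recurrence_time (path_shift (int s) w) k i = enat s"
    and "recurrence_time (path_shift (int t) w) k i = enat t"
  shows "s = t"
proof -
  have False if "s < t" "recurrence_time (path_shift (int s) w) k i = enat s"
    "recurrence_time (path_shift (int t) w) k i = enat t" for s t
    using that visits_split[of 0 "int s" "int t" k w "block k w 0"]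
      visits_split[of "int s" "int s + 1" "int t" k w "block k w 0"]
    by (simp add: recurrence_time_shift_eq_iff visits_singleton)
  then show ?thesis
    using assms by (meson linorder_neqE_nat)
qed

text \<open>
  Only the first \<open>J\<close> occurrences of \<open>b\<close> in the window \<open>{0..m}\<close> can have fewer than \<open>J\<close> predecessors
  in the preceding \<open>m\<close> positions, because these positions cover the part of the window before them.
  Averaged over a stationary process this replaces Kac's formula for the mean recurrence time.
\<close>

lemma card_few_predecessors_le:
  fixes m :: nat
  shows "card {s \<in> {0..int m}. block k w s = b \<and> visits k w b {s - int m..<s} < J} \<le> J"
    (is "card ?B \<le> J")
proof (cases "?B = {}")
  case False
  have fin: "finite ?B"
    by (rule finite_subset[of _ "{0..int m}"]) auto
  define s where "s = Max ?B"
  have s: "s \<in> ?B"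
    using Max_in[OF fin False] by (simp add: s_def)
  have "t \<le> s" if "t \<in> ?B" for t
    using Max_ge[OF fin that] by (simp add: s_def)
  then have "?B - {s} \<subseteq> {t \<in> {s - int m..<s}. block k w t = b}"
    using s by fastforce
  then have "card (?B - {s}) \<le> visits k w b {s - int m..<s}"
    unfolding visits_def by (rule card_mono[rotated]) (auto intro: finite_subset[of _ "{s - int m..<s}"])
  also have "\<dots> < J"
    using s by simp
  finally show ?thesis
    using s fin by (simp add: card_Diff_singleton)
next
  case True
  then show ?thesis by (simp only: card.empty)
qed

section \<open>Measurability\<close>

text \<open>
  The target carries the discrete \<open>\<sigma>\<close>-algebra, as a finite product of finite discrete spaces is
  discrete.  The coordinates outside \<open>I\<close> may be arbitrary functions, so that the lemma also serves
  the \<open>\<sigma>\<close>-algebra of the past, for which \<open>X\<^sub>0\<close> need not be measurable.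
\<close>

lemma measurable_finite_coords:
  fixes Y :: "int \<Rightarrow> 'w \<Rightarrow> 'a" and F :: "(int \<Rightarrow> 'a) \<Rightarrow> 'b"
  assumes "finite S" "finite I"
    and Y: "\<And>t. t \<in> I \<Longrightarrow> Y t \<in> measurable A (count_space S)"
    and F: "\<And>w w'. (\<And>t. t \<in> I \<Longrightarrow> w t = w' t) \<Longrightarrow> F w = F w'"
  shows "(\<lambda>\<omega>. F (\<lambda>t. Y t \<omega>)) \<in> measurable A (count_space UNIV)"
proof -
  have "(\<lambda>\<omega>. \<lambda>t\<in>I. Y t \<omega>) \<in> measurable A (PiM I (\<lambda>_. count_space S))"
    using Y by (rule measurable_restrict)
  also have "PiM I (\<lambda>_. count_space S) = count_space (PiE I (\<lambda>_. S))"
    using assms(1,2) by (intro count_space_PiM_finite) (auto intro: countable_finite)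
  finally have "(\<lambda>\<omega>. F (\<lambda>t\<in>I. Y t \<omega>)) \<in> measurable A (count_space UNIV)"
    by (rule measurable_compose) simp
  also have "(\<lambda>\<omega>. F (\<lambda>t\<in>I. Y t \<omega>)) = (\<lambda>\<omega>. F (\<lambda>t. Y t \<omega>))"
    by (intro ext F) simp
  finally show ?thesis .
qed

lemma measurable_recurrence_time:
  fixes Y :: "int \<Rightarrow> 'w \<Rightarrow> 'a"
  assumes "finite S"
    and Y: "\<And>t. t < 0 \<Longrightarrow> Y t \<in> measurable A (count_space S)"
  shows "(\<lambda>\<omega>. recurrence_time (\<lambda>t. Y t \<omega>) k j) \<in> measurable A (count_space UNIV)"
proof -
  let ?r = "\<lambda>\<omega>. recurrence_time (\<lambda>t. Y t \<omega>) k j"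
  have le: "{\<omega> \<in> space A. ?r \<omega> \<le> enat n} \<in> sets A" for n
  proof -
    have "(\<lambda>\<omega>. recurrence_time (\<lambda>t. Y t \<omega>) k j \<le> enat n) \<in> measurable A (count_space UNIV)"
    proof (rule measurable_finite_coords[OF assms(1), where I = "{- int k - int n..<0}"])
      fix w w' :: "int \<Rightarrow> 'a"
      assume eq: "\<And>t. t \<in> {- int k - int n..<0} \<Longrightarrow> w t = w' t"
      have "block k w t = block k w' t" if "- int n \<le> t" "t \<le> 0" for t
        using that by (intro block_cong eq) auto
      then have "{t \<in> {- int n..<0}. block k w t = block k w 0} =
                 {t \<in> {- int n..<0}. block k w' t = block k w' 0}"
        by auto
      then show "(recurrence_time w k j \<le> enat n) = (recurrence_time w' k j \<le> enat n)"
        by (simp add: recurrence_time_le_iff visits_def)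
    qed (auto intro: Y)
    then show ?thesis by simp
  qed
  have le': "{\<omega> \<in> space A. ?r \<omega> \<le> a} \<in> sets A" for a
    using le by (cases a) auto
  have lt: "{\<omega> \<in> space A. ?r \<omega> < a} \<in> sets A" for a
  proof -
    have "{\<omega> \<in> space A. ?r \<omega> < a} = (\<Union>n\<in>{n. enat n < a}. {\<omega> \<in> space A. ?r \<omega> \<le> enat n})"
    proof (intro set_eqI iffI)
      fix \<omega> assume "\<omega> \<in> {\<omega> \<in> space A. ?r \<omega> < a}"
      then show "\<omega> \<in> (\<Union>n\<in>{n. enat n < a}. {\<omega> \<in> space A. ?r \<omega> \<le> enat n})"
        by (cases "?r \<omega>") auto
    qed (auto intro: le_less_trans)
    also have "\<dots> \<in> sets A"
      using le by (intro sets.countable_UN'') auto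
    finally show ?thesis .
  qed
  have "?r -` {a} \<inter> space A = {\<omega> \<in> space A. ?r \<omega> \<le> a} - {\<omega> \<in> space A. ?r \<omega> < a}" for a
    by auto
  then show ?thesis
    using le' lt by (simp add: measurable_count_space_eq2_countable)
qed

section \<open>Shift invariance\<close>

locale finite_stationary_process = prob_space M for M :: "'w measure" +
  fixes S :: "'a set" and X :: "int \<Rightarrow> 'w \<Rightarrow> 'a"
  assumes finite_S: "finite S"
    and stationary: "stationary_process M (count_space S) X"
begin

definition path :: "'w \<Rightarrow> int \<Rightarrow> 'a" where
  "path \<omega> = (\<lambda>t. X t \<omega>)"

lemma path_apply [simp]: "path \<omega> t = X t \<omega>"
  by (simp add: path_def)

abbreviation paths :: "(int \<Rightarrow> 'a) measure" where
  "paths \<equiv> \<Pi>\<^sub>M t\<in>UNIV. count_space S"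

lemma integrable_bounded:
  fixes f :: "'w \<Rightarrow> real"
  assumes "f \<in> borel_measurable M" "\<And>\<omega>. \<omega> \<in> space M \<Longrightarrow> \<bar>f \<omega>\<bar> \<le> C"
  shows "integrable M f"
  using assms by (intro integrable_const_bound[of _ C]) auto

lemma measurable_X: "X t \<in> measurable M (count_space S)"
  using stationary by (auto simp: stationary_process_def)

lemma X_in_S: "\<omega> \<in> space M \<Longrightarrow> X t \<omega> \<in> S"
  using measurable_space[OF measurable_X] by simp

lemma measurable_path [measurable]: "path \<in> measurable M paths"
  unfolding path_def[abs_def]
  by (rule measurable_PiM_single') (auto intro: measurable_X X_in_S)

lemma measurable_path_shift [measurable]: "path_shift s \<in> measurable paths paths"
  unfolding path_shift_def by (rule measurable_PiM_single') (auto simp: space_PiM)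

lemma distr_shift: "distr M paths (\<lambda>\<omega>. path_shift s (path \<omega>)) = distr M paths path"
  using stationary by (auto simp: stationary_process_def path_shift_def path_def[abs_def])

lemma expectation_shift:
  fixes V :: "(int \<Rightarrow> 'a) \<Rightarrow> real"
  assumes [measurable]: "V \<in> borel_measurable paths"
  shows "expectation (\<lambda>\<omega>. V (path_shift s (path \<omega>))) = expectation (\<lambda>\<omega>. V (path \<omega>))"
proof -
  have "expectation (\<lambda>\<omega>. V (path_shift s (path \<omega>))) =
        (\<integral>w. V w \<partial>distr M paths (\<lambda>\<omega>. path_shift s (path \<omega>)))"
    by (subst integral_distr) auto
  also have "\<dots> = expectation (\<lambda>\<omega>. V (path \<omega>))"
    unfolding distr_shift by (subst integral_distr) auto
  finally show ?thesis .
qed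

lemma prob_shift:
  assumes [measurable]: "Measurable.pred paths \<Phi>"
  shows "prob {\<omega> \<in> space M. \<Phi> (path_shift s (path \<omega>))} = prob {\<omega> \<in> space M. \<Phi> (path \<omega>)}"
proof -
  have *: "prob {\<omega> \<in> space M. \<Phi> (g \<omega>)} = expectation (\<lambda>\<omega>. indicator {w. \<Phi> w} (g \<omega>))"
    if [measurable]: "g \<in> measurable M paths" for g
  proof -
    have "expectation (\<lambda>\<omega>. indicator {w. \<Phi> w} (g \<omega>)) =
          expectation (indicator {\<omega> \<in> space M. \<Phi> (g \<omega>)})"
      by (rule Bochner_Integration.integral_cong) (auto simp: indicator_def)
    also have "\<dots> = prob ({\<omega> \<in> space M. \<Phi> (g \<omega>)} \<inter> space M)"
      by (rule Bochner_Integration.integral_indicator)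
    also have "{\<omega> \<in> space M. \<Phi> (g \<omega>)} \<inter> space M = {\<omega> \<in> space M. \<Phi> (g \<omega>)}"
      by auto
    finally show ?thesis ..
  qed
  have [measurable]: "(indicator {w. \<Phi> w} :: _ \<Rightarrow> real) \<in> borel_measurable paths"
  proof -
    have "(\<lambda>w. if \<Phi> w then 1 else 0 :: real) \<in> borel_measurable paths"
      by measurable
    then show ?thesis by (simp add: indicator_def[abs_def])
  qed
  have "prob {\<omega> \<in> space M. \<Phi> (path_shift s (path \<omega>))} =
        expectation (\<lambda>\<omega>. indicator {w. \<Phi> w} (path_shift s (path \<omega>)))"
    by (rule *) measurable
  also have "\<dots> = expectation (\<lambda>\<omega>. indicator {w. \<Phi> w} (path \<omega>))"
    by (rule expectation_shift) measurable
  also have "\<dots> = prob {\<omega> \<in> space M. \<Phi> (path \<omega>)}"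
    by (rule *[symmetric]) measurable
  finally show ?thesis .
qed

lemma measurable_paths_finite_coords:
  assumes "finite I" "\<And>w w'. (\<And>t. t \<in> I \<Longrightarrow> w t = w' t) \<Longrightarrow> F w = F w'"
  shows "F \<in> measurable paths (count_space UNIV)"
  by (rule measurable_finite_coords[where Y = "\<lambda>t w. w t", OF finite_S assms(1) _ assms(2)])
    (auto intro: measurable_component_singleton)

lemma measurable_block_eq [measurable]: "Measurable.pred paths (\<lambda>w. block k w t = b)"
proof (rule measurable_paths_finite_coords)
  fix w w' :: "int \<Rightarrow> 'a" assume "\<And>r. r \<in> {t - int k..<t} \<Longrightarrow> w r = w' r"
  then have "block k w t = block k w' t"
    by (intro block_cong) auto
  then show "(block k w t = b) = (block k w' t = b)" by simp
qed simp

lemma measurable_visits [measurable]: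
  "(\<lambda>w. visits k w b {u..<v}) \<in> measurable paths (count_space UNIV)"
proof (rule measurable_paths_finite_coords)
  fix w w' :: "int \<Rightarrow> 'a" assume eq: "\<And>r. r \<in> {u - int k..<v} \<Longrightarrow> w r = w' r"
  have "block k w t = block k w' t" if "t \<in> {u..<v}" for t
    using that by (intro block_cong eq) auto
  then have "{t \<in> {u..<v}. block k w t = b} = {t \<in> {u..<v}. block k w' t = b}"
    by auto
  then show "visits k w b {u..<v} = visits k w' b {u..<v}"
    by (simp add: visits_def)
qed simp

lemma measurable_coordinate_eq [measurable]: "Measurable.pred paths (\<lambda>w. w t = x)"
  by (rule measurable_paths_finite_coords[where I = "{t}"]) auto

lemma measurable_fun_block [measurable]:
  "(\<lambda>w. f (block k w t) :: real) \<in> borel_measurable paths"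
proof (rule measurable_compose[of "\<lambda>w. block k w t"])
  show "(\<lambda>w. block k w t) \<in> measurable paths (count_space UNIV)"
    by (rule measurable_paths_finite_coords[where I = "{t - int k..<t}"]) (auto intro: block_cong)
qed simp

lemma measurable_recurrence_time_paths [measurable]:
  "(\<lambda>w. recurrence_time w k j) \<in> measurable paths (count_space UNIV)"
  by (rule measurable_recurrence_time[where Y = "\<lambda>t w. w t", OF finite_S])
    (auto intro: measurable_component_singleton)

section \<open>Recurrence\<close>

definition blocks :: "nat \<Rightarrow> 'a list set" where
  "blocks k = {b. set b \<subseteq> S \<and> length b = k}"

abbreviation past :: "nat \<Rightarrow> 'w \<Rightarrow> 'a list" where
  "past k \<omega> \<equiv> block k (path \<omega>) 0"

lemma finite_blocks [simp]: "finite (blocks k)"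
  unfolding blocks_def using finite_S by (rule finite_lists_length_eq)

lemma past_in_blocks: "\<omega> \<in> space M \<Longrightarrow> past k \<omega> \<in> blocks k"
  by (auto simp: blocks_def set_block X_in_S)

text \<open>
  By stationarity the event has the same probability at each of the origins \<open>0, \<dots>, m\<close>, and on
  every path it occurs at no more than \<open>J\<close> of them.
\<close>

lemma few_visits_prob_le:
  "prob {\<omega> \<in> space M. past k \<omega> = b \<and> visits k (path \<omega>) b {- int m..<0} < J} \<le>
   real J / (real m + 1)"
proof -
  define \<Phi> where "\<Phi> w \<longleftrightarrow> block k w 0 = b \<and> visits k w b {- int m..<0} < J" for w
  have [measurable]: "Measurable.pred paths \<Phi>"
    unfolding \<Phi>_def by measurable
  have path_shift: "\<Phi> (path_shift s w) \<longleftrightarrow> block k w s = b \<and> visits k w b {s - int m..<s} < J" for s w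
    by (simp add: \<Phi>_def visits_shift_atLeastLessThan)
  have "(real m + 1) * prob {\<omega> \<in> space M. \<Phi> (path \<omega>)} =
        (\<Sum>s\<in>{0..int m}. prob {\<omega> \<in> space M. \<Phi> (path_shift s (path \<omega>))})"
    by (simp add: prob_shift)
  also have "\<dots> = (\<Sum>s\<in>{0..int m}. expectation (indicator {\<omega> \<in> space M. \<Phi> (path_shift s (path \<omega>))}))"
    by simp
  also have "\<dots> = expectation (\<lambda>\<omega>. \<Sum>s\<in>{0..int m}. indicator {\<omega> \<in> space M. \<Phi> (path_shift s (path \<omega>))} \<omega>)"
    by (rule Bochner_Integration.integral_sum[symmetric])
      (intro integrable_bounded[of _ 1]; simp add: indicator_def)
  also have "\<dots> \<le> expectation (\<lambda>\<omega>. real J)"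
  proof (rule integral_mono)
    fix \<omega> assume "\<omega> \<in> space M"
    then have "(\<Sum>s\<in>{0..int m}. indicator {\<omega> \<in> space M. \<Phi> (path_shift s (path \<omega>))} \<omega>) =
        (\<Sum>s\<in>{0..int m}. if \<Phi> (path_shift s (path \<omega>)) then 1 else 0 :: real)"
      by (intro sum.cong) (auto simp: indicator_def)
    also have "\<dots> = card {s \<in> {0..int m}. \<Phi> (path_shift s (path \<omega>))}"
      by (simp add: sum.If_cases Int_def)
    also have "\<dots> \<le> J"
      unfolding path_shift of_nat_le_iff by (rule card_few_predecessors_le)
    finally show "(\<Sum>s\<in>{0..int m}. indicator {\<omega> \<in> space M. \<Phi> (path_shift s (path \<omega>))} \<omega>) \<le> real J" .
  next
    show "integrable M (\<lambda>\<omega>. \<Sum>s\<in>{0..int m}. indicator {\<omega> \<in> space M. \<Phi> (path_shift s (path \<omega>))} \<omega> :: real)"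
      by (intro Bochner_Integration.integrable_sum integrable_bounded[of _ 1])
        (simp_all add: indicator_def)
  qed simp
  also have "\<dots> = real J"
    by (simp add: prob_space)
  finally show ?thesis
    by (simp add: \<Phi>_def field_simps)
qed

lemma late_recurrence_prob_le:
  "prob {\<omega> \<in> space M. past k \<omega> = b \<and> \<not> recurrence_time (path \<omega>) k j \<le> enat m} \<le>
   real j / (real m + 1)"
proof -
  have "{\<omega> \<in> space M. past k \<omega> = b \<and> \<not> recurrence_time (path \<omega>) k j \<le> enat m} =
        {\<omega> \<in> space M. past k \<omega> = b \<and> visits k (path \<omega>) b {- int m..<0} < j}"
    by (auto simp: recurrence_time_le_iff)
  then show ?thesis
    using few_visits_prob_le by simp
qed

lemma AE_recurrence_time_finite: "AE \<omega> in M. recurrence_time (path \<omega>) k j \<noteq> \<infinity>"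
proof -
  have *: "AE \<omega> in M. \<not> (past k \<omega> = b \<and> recurrence_time (path \<omega>) k j = \<infinity>)" for b
  proof -
    let ?N = "{\<omega> \<in> space M. past k \<omega> = b \<and> recurrence_time (path \<omega>) k j = \<infinity>}"
    have "prob ?N \<le> real j / (real m + 1)" for m
      by (rule order_trans[OF finite_measure_mono late_recurrence_prob_le[of k b j m]]) auto
    moreover have "(\<lambda>m. real j / (real m + 1)) \<longlonglongrightarrow> 0"
      using tendsto_divide_0[OF tendsto_const filterlim_at_top_imp_at_infinity[OF
            filterlim_tendsto_add_at_top[OF tendsto_const filterlim_real_sequentially]], of "real j" 1]
      by (simp add: add.commute)
    ultimately have "prob ?N \<le> 0"
      by (intro LIMSEQ_le_const) auto
    then have "prob ?N = 0"
      by (simp add: measure_le_0_iff)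
    then show ?thesis
      by (subst (asm) prob_eq_0) auto
  qed
  have "AE \<omega> in M. \<forall>b\<in>blocks k. \<not> (past k \<omega> = b \<and> recurrence_time (path \<omega>) k j = \<infinity>)"
    using * by (intro AE_finite_allI) auto
  then show ?thesis
    using AE_space by eventually_elim (use past_in_blocks in auto)
qed

lemma expectation_disjoint_cover:
  fixes f :: "'w \<Rightarrow> real"
  assumes "integrable M f" and [measurable]: "\<And>n :: nat. A n \<in> events"
    and "\<And>m n. m \<noteq> n \<Longrightarrow> A m \<inter> A n = {}" and "AE \<omega> in M. \<omega> \<in> (\<Union>n. A n)"
  shows "expectation f = (\<Sum>n. expectation (\<lambda>\<omega>. indicator (A n) \<omega> * f \<omega>))"
proof -
  have [measurable]: "f \<in> borel_measurable M"
    using assms(1) by auto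
  have "expectation f = (LINT \<omega>:(\<Union>n. A n)|M. f \<omega>)"
    unfolding set_lebesgue_integral_def
    by (rule integral_cong_AE) (use assms(4) in auto)
  also have "\<dots> = (\<Sum>n. (LINT \<omega>:A n|M. f \<omega>))"
  proof (rule lebesgue_integral_countable_add)
    show "set_integrable M (\<Union>n. A n) f"
      unfolding set_integrable_def using assms(1) by (intro integrable_mult_indicator) auto
  qed (use assms in auto)
  finally show ?thesis
    by (simp add: set_lebesgue_integral_def)
qed

text \<open>
  On the event that \<open>n\<close> is the \<open>i\<close>-th recurrence time, shifting by \<open>-n\<close> turns the expectation into
  one over the event \<open>B n\<close> that \<open>n\<close> is the \<open>i\<close>-th return time into the future.  The events \<open>B n\<close>
  are disjoint and have the same probabilities as those of the recurrence times, which add up to 1;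
  so they too cover almost every path.
\<close>

lemma expectation_at_recurrence:
  fixes V :: "(int \<Rightarrow> 'a) \<Rightarrow> real"
  assumes [measurable]: "V \<in> borel_measurable paths" and bound: "\<And>w. \<bar>V w\<bar> \<le> C"
  shows "expectation (\<lambda>\<omega>. V (path_shift (- int (the_enat (recurrence_time (path \<omega>) k i))) (path \<omega>))) =
         expectation (\<lambda>\<omega>. V (path \<omega>))"
proof -
  define A where "A n = {\<omega> \<in> space M. recurrence_time (path \<omega>) k i = enat n}" for n
  define B where "B n = {\<omega> \<in> space M. recurrence_time (path_shift (int n) (path \<omega>)) k i = enat n}" for n
  let ?f = "\<lambda>\<omega>. V (path_shift (- int (the_enat (recurrence_time (path \<omega>) k i))) (path \<omega>))"
  have A [measurable]: "A n \<in> events" for n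
    unfolding A_def by measurable
  have B [measurable]: "B n \<in> events" for n
    unfolding B_def by measurable
  have [measurable]: "?f \<in> borel_measurable M"
    by (rule measurable_compose_countable[where f = "\<lambda>t \<omega>. V (path_shift (- int (the_enat t)) (path \<omega>))"])
      measurable
  have A_cover: "AE \<omega> in M. \<omega> \<in> (\<Union>n. A n)"
    using AE_recurrence_time_finite[of k i] AE_space by eventually_elim (auto simp: A_def)
  have A_disj: "A m \<inter> A n = {}" if "m \<noteq> n" for m n
    using that by (auto simp: A_def)
  have B_disj: "B m \<inter> B n = {}" if "m \<noteq> n" for m n
    using that unfolding B_def by (blast dest: recurrence_time_shift_inj)
  have transport: "expectation (\<lambda>\<omega>. indicator (A n) \<omega> * ?f \<omega>) =
      expectation (\<lambda>\<omega>. indicator (B n) \<omega> * V (path \<omega>))" for n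
  proof -
    let ?W = "\<lambda>w. if recurrence_time (path_shift (int n) w) k i = enat n then V w else 0"
    have sh: "path_shift (int n) (path_shift (- int n) w) = w" for w :: "int \<Rightarrow> 'a"
      by (simp add: path_shift_def)
    have "expectation (\<lambda>\<omega>. indicator (A n) \<omega> * ?f \<omega>) =
          expectation (\<lambda>\<omega>. ?W (path_shift (- int n) (path \<omega>)))"
      by (rule Bochner_Integration.integral_cong) (auto simp: A_def sh)
    also have "\<dots> = expectation (\<lambda>\<omega>. ?W (path \<omega>))"
      by (rule expectation_shift) measurable
    also have "\<dots> = expectation (\<lambda>\<omega>. indicator (B n) \<omega> * V (path \<omega>))"
      by (rule Bochner_Integration.integral_cong) (auto simp: B_def)
    finally show ?thesis .
  qed
  have "prob (A n) = prob (B n)" for n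
  proof -
    have "Measurable.pred paths (\<lambda>w. recurrence_time w k i = enat n)"
      by measurable
    from prob_shift[OF this, of "int n"] show ?thesis
      by (simp add: A_def B_def)
  qed
  moreover have "(\<lambda>n. prob (A n)) sums prob (\<Union>n. A n)"
    by (rule finite_measure_UNION) (auto simp: disjoint_family_on_def A_disj)
  moreover have "(\<lambda>n. prob (B n)) sums prob (\<Union>n. B n)"
    by (rule finite_measure_UNION) (auto simp: disjoint_family_on_def B_disj)
  ultimately have "prob (\<Union>n. B n) = prob (\<Union>n. A n)"
    by (simp add: sums_unique2)
  also have "\<dots> = 1"
    using A_cover by (subst prob_eq_1) auto
  finally have B_cover: "AE \<omega> in M. \<omega> \<in> (\<Union>n. B n)"
    by (subst (asm) prob_eq_1) auto
  have "expectation ?f = (\<Sum>n. expectation (\<lambda>\<omega>. indicator (A n) \<omega> * ?f \<omega>))"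
    by (rule expectation_disjoint_cover[OF integrable_bounded[of _ C] A A_disj A_cover])
      (auto intro: bound)
  also have "\<dots> = expectation (\<lambda>\<omega>. V (path \<omega>))"
    unfolding transport
    by (rule expectation_disjoint_cover[OF integrable_bounded[of _ C] B B_disj B_cover, symmetric])
      (auto intro: bound)
  finally show ?thesis .
qed

section \<open>Conditional probabilities given the past\<close>

abbreviation past_events :: "'w measure" where
  "past_events \<equiv> past_algebra M (count_space S) X"

abbreviation cond_prob :: "'a \<Rightarrow> 'w \<Rightarrow> real" where
  "cond_prob x \<equiv> past_cond_prob M (count_space S) X x"

lemma space_past_events [simp]: "space past_events = space M"
  unfolding past_algebra_def by (rule space_measure_of) auto

lemma sets_past_events:
  "sets past_events =
   sigma_sets (space M) {X t -` A \<inter> space M | t A. t < 0 \<and> A \<in> sets (count_space S)}"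
  unfolding past_algebra_def by (rule sets_measure_of) auto

lemma subalgebra_past_events: "subalgebra M past_events"
  unfolding subalgebra_def sets_past_events
  by (auto intro!: sets.sigma_sets_subset measurable_sets[OF measurable_X])

sublocale past: finite_measure_subalgebra M past_events
  by unfold_locales (rule subalgebra_past_events)

lemma measurable_X_past:
  assumes "t < 0"
  shows "X t \<in> measurable past_events (count_space S)"
proof (rule measurableI)
  fix A assume "A \<in> sets (count_space S)"
  then show "X t -` A \<inter> space past_events \<in> sets past_events"
    unfolding sets_past_events space_past_events using assms by (intro sigma_sets.Basic) auto
qed (simp add: X_in_S)

lemma measurable_fun_past [measurable]:
  "(\<lambda>\<omega>. f (past k \<omega>) :: real) \<in> borel_measurable past_events"
proof (rule measurable_compose[of "\<lambda>\<omega>. past k \<omega>"])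
  show "(\<lambda>\<omega>. past k \<omega>) \<in> measurable past_events (count_space UNIV)"
    unfolding path_def
  proof (rule measurable_finite_coords[OF finite_S, where I = "{- int k..<0}" and F = "\<lambda>w. block k w 0"])
    fix w w' :: "int \<Rightarrow> 'a" assume "\<And>t. t \<in> {- int k..<0} \<Longrightarrow> w t = w' t"
    then show "block k w 0 = block k w' 0" by (intro block_cong) auto
  qed (auto intro: measurable_X_past)
qed simp

lemma integrable_fun_past [simp]: "integrable M (\<lambda>\<omega>. f (past k \<omega>) :: real)"
proof (rule integrable_const_bound[of _ "Max ((\<lambda>b. \<bar>f b\<bar>) ` blocks k)"])
  show "AE \<omega> in M. norm (f (past k \<omega>)) \<le> Max ((\<lambda>b. \<bar>f b\<bar>) ` blocks k)"
    using AE_space by eventually_elim (auto intro!: Max_ge past_in_blocks)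
qed (rule measurable_from_subalg[OF subalgebra_past_events measurable_fun_past])

lemma cond_prob_measurable [measurable]:
  "cond_prob x \<in> borel_measurable past_events" "cond_prob x \<in> borel_measurable M"
  unfolding past_cond_prob_def by auto

lemma pred_X_eq [measurable]: "{\<omega> \<in> space M. X t \<omega> = x} \<in> events"
  using measurable_compose[OF measurable_path measurable_coordinate_eq[of t x]] by simp

lemma integrable_cond_prob [simp]: "integrable M (cond_prob x)"
  unfolding past_cond_prob_def
  by (intro past.real_cond_exp_int integrable_bounded[of _ 1]) (auto simp: indicator_def)

lemma expectation_cond_prob:
  assumes W: "W \<in> borel_measurable past_events" and bound: "\<And>\<omega>. \<omega> \<in> space M \<Longrightarrow> \<bar>W \<omega>\<bar> \<le> C"
  shows "integrable M (\<lambda>\<omega>. W \<omega> * cond_prob x \<omega>)"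
    "expectation (\<lambda>\<omega>. W \<omega> * cond_prob x \<omega>) =
     expectation (\<lambda>\<omega>. W \<omega> * indicator {\<omega> \<in> space M. X 0 \<omega> = x} \<omega>)"
proof -
  have [measurable]: "W \<in> borel_measurable M"
    using measurable_from_subalg[OF subalgebra_past_events W] .
  have "integrable M (\<lambda>\<omega>. W \<omega> * indicator {\<omega> \<in> space M. X 0 \<omega> = x} \<omega>)"
  proof (rule integrable_bounded[of _ C])
    show "\<bar>W \<omega> * indicator {\<omega> \<in> space M. X 0 \<omega> = x} \<omega>\<bar> \<le> C" if "\<omega> \<in> space M" for \<omega>
      using bound[OF that] by (auto simp: indicator_def)
  qed measurable
  from past.real_cond_exp_intg[OF this W] show
    "integrable M (\<lambda>\<omega>. W \<omega> * cond_prob x \<omega>)"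
    "expectation (\<lambda>\<omega>. W \<omega> * cond_prob x \<omega>) =
     expectation (\<lambda>\<omega>. W \<omega> * indicator {\<omega> \<in> space M. X 0 \<omega> = x} \<omega>)"
    by (auto simp: past_cond_prob_def)
qed

definition block_prob :: "'a list \<Rightarrow> real" where
  "block_prob b = prob {\<omega> \<in> space M. past (length b) \<omega> = b}"

definition cond_mass :: "'a \<Rightarrow> 'a list \<Rightarrow> real" where
  "cond_mass x b = block_prob (b @ [x]) / block_prob b"

lemma block_prob_snoc:
  "block_prob (b @ [x]) = prob {\<omega> \<in> space M. past (length b) \<omega> = b \<and> X 0 \<omega> = x}"
proof -
  let ?k = "length b"
  have "block_prob (b @ [x]) =
        prob {\<omega> \<in> space M. block (Suc ?k) (path_shift 1 (path \<omega>)) 0 = b @ [x]}"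
    unfolding block_prob_def using prob_shift[OF measurable_block_eq[of "Suc ?k" 0 "b @ [x]"], of 1] by simp
  also have "\<dots> = prob {\<omega> \<in> space M. past ?k \<omega> = b \<and> X 0 \<omega> = x}"
    using block_snoc[of ?k "path _" 0] by simp
  finally show ?thesis .
qed

lemma block_prob_nonneg [simp]: "0 \<le> block_prob b"
  by (simp add: block_prob_def)

lemma block_prob_snoc_le: "block_prob (b @ [x]) \<le> block_prob b"
  unfolding block_prob_snoc block_prob_def[of b] by (rule finite_measure_mono) auto

lemma cond_mass_nonneg [simp]: "0 \<le> cond_mass x b"
  by (simp add: cond_mass_def)

lemma cond_mass_le_1 [simp]: "cond_mass x b \<le> 1"
  using block_prob_snoc_le[of b x] block_prob_nonneg[of b]
  by (cases "block_prob b = 0") (auto simp: cond_mass_def divide_le_eq_1 less_le)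

lemma block_prob_mult_cond_mass: "block_prob b * cond_mass x b = block_prob (b @ [x])"
  using block_prob_snoc_le[of b x]
  by (cases "block_prob b = 0") (auto simp: cond_mass_def intro: order.antisym)

lemma expectation_partition:
  fixes f :: "'w \<Rightarrow> real"
  assumes "integrable M f"
  shows "expectation f =
         (\<Sum>b\<in>blocks k. expectation (\<lambda>\<omega>. indicator {\<omega> \<in> space M. past k \<omega> = b} \<omega> * f \<omega>))"
proof -
  have "expectation f =
        expectation (\<lambda>\<omega>. \<Sum>b\<in>blocks k. indicator {\<omega> \<in> space M. past k \<omega> = b} \<omega> * f \<omega>)"
  proof (rule Bochner_Integration.integral_cong)
    fix \<omega> assume \<omega>: "\<omega> \<in> space M"
    have "(\<Sum>b\<in>blocks k. indicator {\<omega> \<in> space M. past k \<omega> = b} \<omega> * f \<omega>) =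
          (\<Sum>b\<in>blocks k. if b = past k \<omega> then f \<omega> else 0)"
      using \<omega> by (intro sum.cong) (auto simp: indicator_def)
    also have "\<dots> = f \<omega>"
      using past_in_blocks[OF \<omega>] by simp
    finally show "f \<omega> = (\<Sum>b\<in>blocks k. indicator {\<omega> \<in> space M. past k \<omega> = b} \<omega> * f \<omega>)" ..
  qed simp
  also have "\<dots> = (\<Sum>b\<in>blocks k. expectation (\<lambda>\<omega>. indicator {\<omega> \<in> space M. past k \<omega> = b} \<omega> * f \<omega>))"
    using assms by (intro Bochner_Integration.integral_sum) (auto intro!: integrable_real_mult_indicator simp: mult.commute)
  finally show ?thesis .
qed

lemma integrable_fun_past_mult_indicator:
  assumes [measurable]: "E \<in> events"
  shows "integrable M (\<lambda>\<omega>. f (past k \<omega>) * indicator E \<omega> :: real)"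
  by (rule integrable_real_mult_indicator) auto

lemma expectation_fun_past_mult_indicator:
  assumes [measurable]: "E \<in> events"
  shows "expectation (\<lambda>\<omega>. f (past k \<omega>) * indicator E \<omega>) =
         (\<Sum>b\<in>blocks k. f b * prob {\<omega> \<in> E. past k \<omega> = b})"
proof -
  have "expectation (\<lambda>\<omega>. f (past k \<omega>) * indicator E \<omega>) = (\<Sum>b\<in>blocks k.
      expectation (\<lambda>\<omega>. indicator {\<omega> \<in> space M. past k \<omega> = b} \<omega> * (f (past k \<omega>) * indicator E \<omega>)))"
    by (rule expectation_partition) (rule integrable_fun_past_mult_indicator[OF assms])
  also have "\<dots> = (\<Sum>b\<in>blocks k. f b * prob {\<omega> \<in> E. past k \<omega> = b})"
  proof (rule sum.cong)
    fix b
    have sub: "E \<subseteq> space M"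
      using assms by (rule sets.sets_into_space)
    have "expectation (\<lambda>\<omega>. indicator {\<omega> \<in> space M. past k \<omega> = b} \<omega> * (f (past k \<omega>) * indicator E \<omega>)) =
          expectation (\<lambda>\<omega>. f b * indicator {\<omega> \<in> E. past k \<omega> = b} \<omega>)"
      by (rule Bochner_Integration.integral_cong) (auto simp: indicator_def)
    also have "\<dots> = f b * prob ({\<omega> \<in> E. past k \<omega> = b} \<inter> space M)"
      by simp
    also have "{\<omega> \<in> E. past k \<omega> = b} \<inter> space M = {\<omega> \<in> E. past k \<omega> = b}"
      using sub by auto
    finally show "expectation (\<lambda>\<omega>. indicator {\<omega> \<in> space M. past k \<omega> = b} \<omega> * (f (past k \<omega>) * indicator E \<omega>)) =
        f b * prob {\<omega> \<in> E. past k \<omega> = b}" .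
  qed simp
  finally show ?thesis .
qed

lemma expectation_fun_past:
  "expectation (\<lambda>\<omega>. f (past k \<omega>)) = (\<Sum>b\<in>blocks k. f b * block_prob b)"
proof -
  have "expectation (\<lambda>\<omega>. f (past k \<omega>)) = expectation (\<lambda>\<omega>. f (past k \<omega>) * indicator (space M) \<omega>)"
    by (rule Bochner_Integration.integral_cong) auto
  also have "\<dots> = (\<Sum>b\<in>blocks k. f b * prob {\<omega> \<in> space M. past k \<omega> = b})"
    by (rule expectation_fun_past_mult_indicator) simp
  also have "\<dots> = (\<Sum>b\<in>blocks k. f b * block_prob b)"
    by (rule sum.cong) (auto simp: block_prob_def blocks_def)
  finally show ?thesis .
qed

lemma expectation_cond_mass:
  "expectation (\<lambda>\<omega>. f (past k \<omega>) * cond_mass x (past k \<omega>)) =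
   expectation (\<lambda>\<omega>. f (past k \<omega>) * indicator {\<omega> \<in> space M. X 0 \<omega> = x} \<omega>)"
proof -
  have "expectation (\<lambda>\<omega>. f (past k \<omega>) * indicator {\<omega> \<in> space M. X 0 \<omega> = x} \<omega>) =
        (\<Sum>b\<in>blocks k. f b * prob {\<omega> \<in> {\<omega> \<in> space M. X 0 \<omega> = x}. past k \<omega> = b})"
    by (rule expectation_fun_past_mult_indicator) simp
  also have "\<dots> = (\<Sum>b\<in>blocks k. f b * block_prob (b @ [x]))"
    by (intro sum.cong refl arg_cong2[where f = "(*)"])
      (auto simp: block_prob_snoc blocks_def intro!: arg_cong[where f = prob])
  also have "\<dots> = expectation (\<lambda>\<omega>. f (past k \<omega>) * cond_mass x (past k \<omega>))"
    unfolding expectation_fun_past[of "\<lambda>b. f b * cond_mass x b"]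
    by (simp add: mult.assoc mult.commute[of "cond_mass _ _"] block_prob_mult_cond_mass)
  finally show ?thesis ..
qed

section \<open>Convergence of finite-block conditional probabilities\<close>

definition past_gap :: "nat \<Rightarrow> 'a \<Rightarrow> real" where
  "past_gap k x = expectation (\<lambda>\<omega>. \<bar>cond_prob x \<omega> - cond_mass x (past k \<omega>)\<bar>)"

definition past_approximable :: "('w \<Rightarrow> real) \<Rightarrow> bool" where
  "past_approximable g \<longleftrightarrow> integrable M g \<and>
     (\<forall>\<epsilon>>0. \<exists>k h. expectation (\<lambda>\<omega>. \<bar>g \<omega> - h (past k \<omega>)\<bar>) < \<epsilon>)"

lemma fun_past_lift:
  assumes "k \<le> m"
  shows "h (past k \<omega>) = (\<lambda>b. h (drop (m - k) b)) (past m \<omega>)"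
  by (simp only: drop_block[OF assms])

lemma past_approximable_combine:
  assumes f: "past_approximable f" and g: "past_approximable g"
    and F: "\<And>a b c d. \<bar>F a b - F c d\<bar> \<le> \<bar>a - c\<bar> + \<bar>b - d\<bar>"
    and int: "integrable M (\<lambda>\<omega>. F (f \<omega>) (g \<omega>))"
  shows "past_approximable (\<lambda>\<omega>. F (f \<omega>) (g \<omega>))"
  unfolding past_approximable_def
proof (intro conjI allI impI int)
  fix \<epsilon> :: real assume "\<epsilon> > 0"
  then have "\<epsilon> / 2 > 0" by simp
  with f g obtain k h m h' where
    h: "expectation (\<lambda>\<omega>. \<bar>f \<omega> - h (past k \<omega>)\<bar>) < \<epsilon> / 2" and
    h': "expectation (\<lambda>\<omega>. \<bar>g \<omega> - h' (past m \<omega>)\<bar>) < \<epsilon> / 2"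
    unfolding past_approximable_def by meson
  define n where "n = max k m"
  define H where "H b = F (h (drop (n - k) b)) (h' (drop (n - m) b))" for b
  have H: "H (past n \<omega>) = F (h (past k \<omega>)) (h' (past m \<omega>))" for \<omega>
    using fun_past_lift[of k n h \<omega>] fun_past_lift[of m n h' \<omega>] by (simp add: H_def n_def)
  have int_H: "integrable M (\<lambda>\<omega>. F (h (past k \<omega>)) (h' (past m \<omega>)))"
    using integrable_fun_past[of H n] by (simp only: H)
  have [simp]: "integrable M f" "integrable M g"
    using f g by (auto simp: past_approximable_def)
  have "expectation (\<lambda>\<omega>. \<bar>F (f \<omega>) (g \<omega>) - H (past n \<omega>)\<bar>) \<le>
        expectation (\<lambda>\<omega>. \<bar>f \<omega> - h (past k \<omega>)\<bar> + \<bar>g \<omega> - h' (past m \<omega>)\<bar>)"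
    using int int_H by (intro integral_mono) (auto simp: H intro!: F)
  also have "\<dots> < \<epsilon>"
    using h h' by simp
  finally show "\<exists>k h. expectation (\<lambda>\<omega>. \<bar>F (f \<omega>) (g \<omega>) - h (past k \<omega>)\<bar>) < \<epsilon>" by blast
qed

text \<open>
  Together with closure under \<open>1\<close>-Lipschitz operations, closure under dominated limits carries
  approximability from single coordinates to countable unions of events and then to all integrable
  functions of the past.
\<close>

lemma past_approximable_limit:
  assumes s: "\<And>n. past_approximable (s n)" and [measurable]: "g \<in> borel_measurable M"
    and lim: "\<And>\<omega>. \<omega> \<in> space M \<Longrightarrow> (\<lambda>n. s n \<omega>) \<longlonglongrightarrow> g \<omega>"
    and w: "integrable M w" "\<And>n \<omega>. \<omega> \<in> space M \<Longrightarrow> \<bar>s n \<omega>\<bar> \<le> w \<omega>"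
  shows "past_approximable g"
proof -
  have s_int [simp]: "integrable M (s n)" for n
    using s by (simp add: past_approximable_def)
  have [measurable]: "s n \<in> borel_measurable M" for n
    using s_int by (rule borel_measurable_integrable)
  have g_le: "\<bar>g \<omega>\<bar> \<le> w \<omega>" if "\<omega> \<in> space M" for \<omega>
    by (rule LIMSEQ_le_const2[OF tendsto_rabs[OF lim[OF that]]]) (use w(2)[OF that] in auto)
  have g_int [simp]: "integrable M g"
    using w(1)
  proof (rule Bochner_Integration.integrable_bound)
    show "AE \<omega> in M. norm (g \<omega>) \<le> norm (w \<omega>)"
      using g_le by (intro AE_I2) (smt (verit) real_norm_def)
  qed simp
  have "(\<lambda>n. expectation (\<lambda>\<omega>. \<bar>g \<omega> - s n \<omega>\<bar>)) \<longlonglongrightarrow> expectation (\<lambda>\<omega>. 0)"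
  proof (rule integral_dominated_convergence[where w = "\<lambda>\<omega>. 2 * w \<omega>"])
    show "AE \<omega> in M. (\<lambda>n. \<bar>g \<omega> - s n \<omega>\<bar>) \<longlonglongrightarrow> 0"
    proof (intro AE_I2 tendsto_rabs_zero)
      fix \<omega> assume "\<omega> \<in> space M"
      from tendsto_diff[OF tendsto_const lim[OF this], of "g \<omega>"]
      show "(\<lambda>n. g \<omega> - s n \<omega>) \<longlonglongrightarrow> 0" by simp
    qed
    show "AE \<omega> in M. norm \<bar>g \<omega> - s n \<omega>\<bar> \<le> 2 * w \<omega>" for n
      using g_le w(2)[of _ n] by (intro AE_I2) (smt (verit) real_norm_def)
  qed (use w(1) in auto)
  then have lim0: "(\<lambda>n. expectation (\<lambda>\<omega>. \<bar>g \<omega> - s n \<omega>\<bar>)) \<longlonglongrightarrow> 0"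
    by simp
  show ?thesis
    unfolding past_approximable_def
  proof (intro conjI allI impI g_int)
    fix \<epsilon> :: real assume \<epsilon>: "\<epsilon> > 0"
    then have "\<forall>\<^sub>F n in sequentially. expectation (\<lambda>\<omega>. \<bar>g \<omega> - s n \<omega>\<bar>) < \<epsilon> / 2"
      using lim0 by (intro order_tendstoD) auto
    then obtain n where n: "expectation (\<lambda>\<omega>. \<bar>g \<omega> - s n \<omega>\<bar>) < \<epsilon> / 2"
      by (auto simp: eventually_sequentially)
    from \<epsilon> s[of n] obtain k h where h: "expectation (\<lambda>\<omega>. \<bar>s n \<omega> - h (past k \<omega>)\<bar>) < \<epsilon> / 2"
      unfolding past_approximable_def by (meson half_gt_zero)
    have "expectation (\<lambda>\<omega>. \<bar>g \<omega> - h (past k \<omega>)\<bar>) \<le>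
          expectation (\<lambda>\<omega>. \<bar>g \<omega> - s n \<omega>\<bar> + \<bar>s n \<omega> - h (past k \<omega>)\<bar>)"
      by (intro integral_mono) auto
    also have "\<dots> < \<epsilon>"
      using n h by simp
    finally show "\<exists>k h. expectation (\<lambda>\<omega>. \<bar>g \<omega> - h (past k \<omega>)\<bar>) < \<epsilon>" by blast
  qed
qed

lemma past_approximable_fun_past:
  assumes "integrable M g" "\<And>\<omega>. \<omega> \<in> space M \<Longrightarrow> g \<omega> = h (past k \<omega>)"
  shows "past_approximable g"
  unfolding past_approximable_def
proof (intro conjI allI impI assms(1) exI)
  fix \<epsilon> :: real assume "\<epsilon> > 0"
  moreover have "expectation (\<lambda>\<omega>. \<bar>g \<omega> - h (past k \<omega>)\<bar>) = expectation (\<lambda>\<omega>. 0)"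
    using assms(2) by (intro Bochner_Integration.integral_cong) auto
  ultimately show "expectation (\<lambda>\<omega>. \<bar>g \<omega> - h (past k \<omega>)\<bar>) < \<epsilon>" by simp
qed

lemma past_approximable_cong:
  assumes "past_approximable f" "\<And>\<omega>. \<omega> \<in> space M \<Longrightarrow> f \<omega> = g \<omega>"
  shows "past_approximable g"
proof -
  have "integrable M f \<longleftrightarrow> integrable M g"
    using assms(2) by (intro Bochner_Integration.integrable_cong) auto
  moreover have "expectation (\<lambda>\<omega>. \<bar>f \<omega> - h (past k \<omega>)\<bar>) = expectation (\<lambda>\<omega>. \<bar>g \<omega> - h (past k \<omega>)\<bar>)" for k h
    using assms(2) by (intro Bochner_Integration.integral_cong) auto
  ultimately show ?thesis
    using assms(1) by (simp add: past_approximable_def)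
qed

lemma integrable_indicator_event:
  "A \<in> events \<Longrightarrow> integrable M (indicator A :: _ \<Rightarrow> real)"
  by (rule integrable_bounded[of _ 1]) (auto simp: indicator_def)

lemma past_event_approximable:
  assumes "A \<in> sets past_events"
  shows "past_approximable (indicator A)"
  using assms unfolding sets_past_events
proof (induction A rule: sigma_sets.induct)
  case (Basic B)
  then obtain t A where t: "t < 0" and B: "B = X t -` A \<inter> space M" and A: "A \<in> sets (count_space S)"
    by auto
  have "B \<in> events"
    unfolding B by (rule measurable_sets[OF measurable_X A])
  moreover have "indicator B \<omega> = indicator A (past (nat (- t)) \<omega> ! 0)" if "\<omega> \<in> space M" for \<omega>
    using t that by (simp add: nth_block B indicator_def)
  ultimately show ?case
    by (intro past_approximable_fun_past[where k = "nat (- t)" and h = "\<lambda>b. indicator A (b ! 0)"]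
        integrable_indicator_event)
next
  case Empty
  show ?case
    by (rule past_approximable_fun_past[where k = 0 and h = "\<lambda>_. 0"]) auto
next
  case (Compl A)
  have "integrable M (\<lambda>\<omega>. 1 - indicator A \<omega> :: real)"
    using Compl.IH by (auto simp: past_approximable_def)
  then have "past_approximable (\<lambda>\<omega>. 1 - indicator A \<omega>)"
    by (rule past_approximable_combine[OF Compl.IH Compl.IH, of "\<lambda>a b. 1 - a", rotated]) auto
  then show ?case
    by (rule past_approximable_cong) (auto simp: indicator_def)
next
  case (Union A)
  have ev: "A i \<in> events" for i
    using Union.hyps[of i] subalgebra_past_events
    unfolding sets_past_events[symmetric] subalgebra_def by auto
  have fin: "past_approximable (indicator (\<Union>i<n. A i))" for n
  proof (induction n)
    case 0
    show ?case
      by (rule past_approximable_fun_past[where k = 0 and h = "\<lambda>_. 0"]) auto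
  next
    case (Suc n)
    have eq: "(indicator (\<Union>i<Suc n. A i) :: _ \<Rightarrow> real) =
        (\<lambda>\<omega>. max (indicator (\<Union>i<n. A i) \<omega>) (indicator (A n) \<omega>))"
      by (auto simp: indicator_def lessThan_Suc fun_eq_iff)
    have "integrable M (indicator (\<Union>i<Suc n. A i) :: _ \<Rightarrow> real)"
      using ev by (intro integrable_indicator_event) auto
    then show ?case
      unfolding eq by (intro past_approximable_combine[OF Suc.IH Union.IH]) auto
  qed
  show ?case
  proof (rule past_approximable_limit[OF fin, where w = "\<lambda>_. 1"])
    show "(indicator (\<Union>i. A i) :: _ \<Rightarrow> real) \<in> borel_measurable M"
      using ev by auto
    show "(\<lambda>n. indicator (\<Union>i<n. A i) \<omega> :: real) \<longlonglongrightarrow> indicator (\<Union>i. A i) \<omega>" for \<omega>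
    proof (cases "\<exists>i. \<omega> \<in> A i")
      case True
      then obtain i where "\<omega> \<in> A i" ..
      then have "\<forall>\<^sub>F n in sequentially. indicator (\<Union>i<n. A i) \<omega> = (1 :: real)"
        by (auto simp: eventually_sequentially indicator_def intro!: exI[of _ "Suc i"])
      moreover have "indicator (\<Union>i. A i) \<omega> = (1 :: real)"
        using True by auto
      ultimately show ?thesis
        by (simp add: tendsto_eventually)
    qed auto
  qed (auto simp: indicator_def)
qed

lemma past_measurable_approximable:
  assumes "f \<in> borel_measurable past_events" "integrable M f"
  shows "past_approximable f"
proof -
  let ?R = "restr_to_subalg M past_events"
  have from_R: "integrable M g" if "integrable ?R g" for g :: "'w \<Rightarrow> real"
    using integrable_from_subalg[OF subalgebra_past_events that] .
  have "integrable ?R f"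
    using integrable_in_subalg[OF subalgebra_past_events assms] .
  then show ?thesis
  proof (induction rule: integrable_induct)
    case (base A c)
    then have A: "A \<in> sets past_events"
      by (simp add: sets_restr_to_subalg[OF subalgebra_past_events])
    show ?case
      unfolding past_approximable_def
    proof (intro conjI allI impI)
      show int: "integrable M (\<lambda>\<omega>. indicator A \<omega> *\<^sub>R c)"
        using past_event_approximable[OF A] by (auto simp: past_approximable_def)
      fix \<epsilon> :: real assume \<epsilon>: "\<epsilon> > 0"
      then have "\<epsilon> / (\<bar>c\<bar> + 1) > 0" by simp
      then obtain k h where h: "expectation (\<lambda>\<omega>. \<bar>indicator A \<omega> - h (past k \<omega>)\<bar>) < \<epsilon> / (\<bar>c\<bar> + 1)"
        using past_event_approximable[OF A] unfolding past_approximable_def by meson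
      have "expectation (\<lambda>\<omega>. \<bar>indicator A \<omega> *\<^sub>R c - c * h (past k \<omega>)\<bar>) =
            \<bar>c\<bar> * expectation (\<lambda>\<omega>. \<bar>indicator A \<omega> - h (past k \<omega>)\<bar>)"
        by (subst Bochner_Integration.integral_mult_right_zero[symmetric])
          (auto intro!: Bochner_Integration.integral_cong simp flip: abs_mult simp: algebra_simps)
      also have "\<dots> \<le> (\<bar>c\<bar> + 1) * expectation (\<lambda>\<omega>. \<bar>indicator A \<omega> - h (past k \<omega>)\<bar>)"
        by (intro mult_right_mono) auto
      also have "\<dots> < \<epsilon>"
        using h by (simp add: field_simps add_pos_nonneg)
      finally show "\<exists>k h. expectation (\<lambda>\<omega>. \<bar>indicator A \<omega> *\<^sub>R c - h (past k \<omega>)\<bar>) < \<epsilon>"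
        by (intro exI[of _ k] exI[of _ "\<lambda>b. c * h b"])
    qed
  next
    case (add f g)
    then show ?case
      by (intro past_approximable_combine[where F = "(+)"]) (auto intro: from_R)
  next
    case (lim f s)
    have sp: "space ?R = space M"
      by (simp add: space_restr_to_subalg)
    show ?case
    proof (rule past_approximable_limit[where s = s and w = "\<lambda>\<omega>. 2 * \<bar>f \<omega>\<bar>"])
      show "f \<in> borel_measurable M" "integrable M (\<lambda>\<omega>. 2 * \<bar>f \<omega>\<bar>)"
        using from_R[OF \<open>integrable ?R f\<close>] by auto
    qed (use lim sp in auto)
  qed
qed

text \<open>
  The conditional probability given a block of length \<open>m\<close> is the average of \<open>cond_prob\<close> over that
  block, and averaging does not increase the \<open>L\<^sup>1\<close>-distance to a function of the block.  The
  proof tests the difference against its sign, which is itself a function of the block.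
\<close>

lemma past_gap_le:
  assumes "k \<le> m"
  shows "past_gap m x \<le> 2 * expectation (\<lambda>\<omega>. \<bar>cond_prob x \<omega> - h (past k \<omega>)\<bar>)"
proof -
  define h' where "h' b = h (drop (m - k) b)" for b
  have h': "h (past k \<omega>) = h' (past m \<omega>)" for \<omega>
    using fun_past_lift[OF assms, of h] by (simp add: h'_def)
  define \<sigma> where "\<sigma> b = sgn (cond_mass x b - h' b)" for b
  have \<sigma>: "\<bar>\<sigma> b\<bar> \<le> 1" for b
    by (simp add: \<sigma>_def abs_sgn_eq)
  have int: "integrable M (\<lambda>\<omega>. \<sigma> (past m \<omega>) * cond_prob x \<omega>)"
    by (rule expectation_cond_prob[where C = 1]) (auto simp: \<sigma>)
  have int': "integrable M (\<lambda>\<omega>. \<sigma> (past m \<omega>) * h' (past m \<omega>))"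
    using integrable_fun_past[of "\<lambda>b. \<sigma> b * h' b"] .
  have int'': "integrable M (\<lambda>\<omega>. \<sigma> (past m \<omega>) * cond_mass x (past m \<omega>))"
    using integrable_fun_past[of "\<lambda>b. \<sigma> b * cond_mass x b"] .
  have "expectation (\<lambda>\<omega>. \<bar>cond_mass x (past m \<omega>) - h' (past m \<omega>)\<bar>) =
        expectation (\<lambda>\<omega>. \<sigma> (past m \<omega>) * cond_mass x (past m \<omega>) - \<sigma> (past m \<omega>) * h' (past m \<omega>))"
    by (rule Bochner_Integration.integral_cong)
      (simp_all add: \<sigma>_def abs_sgn left_diff_distrib mult.commute)
  also have "\<dots> = expectation (\<lambda>\<omega>. \<sigma> (past m \<omega>) * cond_mass x (past m \<omega>)) -
      expectation (\<lambda>\<omega>. \<sigma> (past m \<omega>) * h' (past m \<omega>))"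
    using int' int'' by (rule Bochner_Integration.integral_diff[rotated])
  also have "expectation (\<lambda>\<omega>. \<sigma> (past m \<omega>) * cond_mass x (past m \<omega>)) =
      expectation (\<lambda>\<omega>. \<sigma> (past m \<omega>) * cond_prob x \<omega>)"
    unfolding expectation_cond_mass
    by (rule expectation_cond_prob(2)[where C = 1, symmetric]) (auto simp: \<sigma>)
  also have "\<dots> - expectation (\<lambda>\<omega>. \<sigma> (past m \<omega>) * h' (past m \<omega>)) =
      expectation (\<lambda>\<omega>. \<sigma> (past m \<omega>) * cond_prob x \<omega> - \<sigma> (past m \<omega>) * h' (past m \<omega>))"
    using int int' by (rule Bochner_Integration.integral_diff[symmetric])
  also have "\<dots> \<le> expectation (\<lambda>\<omega>. \<bar>cond_prob x \<omega> - h' (past m \<omega>)\<bar>)"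
  proof (rule integral_mono)
    fix \<omega>
    have "\<sigma> (past m \<omega>) * (cond_prob x \<omega> - h' (past m \<omega>)) \<le>
          \<bar>\<sigma> (past m \<omega>)\<bar> * \<bar>cond_prob x \<omega> - h' (past m \<omega>)\<bar>"
      by (metis abs_ge_self abs_mult)
    also have "\<dots> \<le> 1 * \<bar>cond_prob x \<omega> - h' (past m \<omega>)\<bar>"
      by (intro mult_right_mono \<sigma>) auto
    finally show "\<sigma> (past m \<omega>) * cond_prob x \<omega> - \<sigma> (past m \<omega>) * h' (past m \<omega>) \<le>
        \<bar>cond_prob x \<omega> - h' (past m \<omega>)\<bar>"
      by (simp add: right_diff_distrib)
  qed (use int int' in auto)
  finally have *: "expectation (\<lambda>\<omega>. \<bar>cond_mass x (past m \<omega>) - h' (past m \<omega>)\<bar>) \<le>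
      expectation (\<lambda>\<omega>. \<bar>cond_prob x \<omega> - h' (past m \<omega>)\<bar>)" .
  have "past_gap m x \<le> expectation (\<lambda>\<omega>. \<bar>cond_prob x \<omega> - h' (past m \<omega>)\<bar> +
      \<bar>cond_mass x (past m \<omega>) - h' (past m \<omega>)\<bar>)"
    unfolding past_gap_def by (intro integral_mono) auto
  also have "\<dots> = expectation (\<lambda>\<omega>. \<bar>cond_prob x \<omega> - h' (past m \<omega>)\<bar>) +
      expectation (\<lambda>\<omega>. \<bar>cond_mass x (past m \<omega>) - h' (past m \<omega>)\<bar>)"
    by (rule Bochner_Integration.integral_add) auto
  finally show ?thesis
    using * by (simp add: h')
qed

lemma past_gap_nonneg: "0 \<le> past_gap k x"
  by (simp add: past_gap_def)

theorem past_gap_tendsto_0: "(\<lambda>k. past_gap k x) \<longlonglongrightarrow> 0"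
proof (rule LIMSEQ_I)
  fix \<epsilon> :: real assume \<epsilon>: "\<epsilon> > 0"
  have "past_approximable (cond_prob x)"
    by (rule past_measurable_approximable) auto
  with \<epsilon> obtain k h where h: "expectation (\<lambda>\<omega>. \<bar>cond_prob x \<omega> - h (past k \<omega>)\<bar>) < \<epsilon> / 2"
    unfolding past_approximable_def by (meson half_gt_zero)
  have "norm (past_gap m x - 0) < \<epsilon>" if "k \<le> m" for m
    using past_gap_le[OF that, of x h] past_gap_nonneg[of m x] h by simp
  then show "\<exists>k. \<forall>m\<ge>k. norm (past_gap m x - 0) < \<epsilon>" by blast
qed

section \<open>The sampling error\<close>

text \<open>
  An infinite recurrence time has probability 0; the value 0 there, instead of a coordinate at an
  unspecified time, makes the error a function of the past for \<open>j > 0\<close>.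
\<close>

definition sample_error :: "'a \<Rightarrow> nat \<Rightarrow> nat \<Rightarrow> (int \<Rightarrow> 'a) \<Rightarrow> real" where
  "sample_error x k j w =
     (case recurrence_time w k j of
        enat t \<Rightarrow> (if w (- int t) = x then 1 else 0) - cond_mass x (block k w 0)
      | \<infinity> \<Rightarrow> 0)"

lemma sample_error_bound: "\<bar>sample_error x k j w\<bar> \<le> 1"
  using cond_mass_nonneg[of x "block k w 0"] cond_mass_le_1[of x "block k w 0"]
  by (auto simp: sample_error_def abs_le_iff simp del: cond_mass_nonneg cond_mass_le_1 split: enat.split)

lemma measurable_sample_error [measurable]: "sample_error x k j \<in> borel_measurable paths"
  unfolding sample_error_def
proof (rule measurable_compose_countable)
  fix i
  show "(\<lambda>w. case i of enat t \<Rightarrow> (if w (- int t) = x then 1 else 0) - cond_mass x (block k w 0)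
      | \<infinity> \<Rightarrow> 0) \<in> borel_measurable paths"
    by (cases i) simp_all
qed simp

text \<open>
  For \<open>j = 0\<close> the error involves \<open>X\<^sub>0\<close>, which is not part of the past; for \<open>j > 0\<close> recurrence
  time 0 is impossible.
\<close>

lemma measurable_sample_error_past:
  assumes "0 < j"
  shows "(\<lambda>\<omega>. sample_error x k j (path \<omega>)) \<in> borel_measurable past_events"
proof -
  have pos: "recurrence_time w k j \<noteq> enat 0" for w :: "int \<Rightarrow> 'a"
    using assms by (simp add: recurrence_time_eq_iff visits_def)
  have "(\<lambda>\<omega>. (\<lambda>i \<omega>. case i of
        enat t \<Rightarrow> if t = 0 then 0 else (if X (- int t) \<omega> = x then 1 else 0) - cond_mass x (past k \<omega>)
      | \<infinity> \<Rightarrow> 0) (recurrence_time (path \<omega>) k j) \<omega>) \<in> borel_measurable past_events"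
  proof (rule measurable_compose_countable)
    show "(\<lambda>\<omega>. recurrence_time (path \<omega>) k j) \<in> measurable past_events (count_space UNIV)"
      unfolding path_def by (rule measurable_recurrence_time[OF finite_S measurable_X_past])
    show "(\<lambda>\<omega>. case i of
        enat t \<Rightarrow> if t = 0 then 0 else (if X (- int t) \<omega> = x then 1 else 0) - cond_mass x (past k \<omega>)
      | \<infinity> \<Rightarrow> 0) \<in> borel_measurable past_events" for i
    proof (cases i)
      case (enat t)
      show ?thesis
      proof (cases "t = 0")
        case False
        then have "- int t < 0" by simp
        note X = measurable_X_past[OF this]
        have "(\<lambda>a. if a = x then 1 else 0 :: real) \<in> borel_measurable (count_space S)"
          by simp
        then have "(\<lambda>\<omega>. (if X (- int t) \<omega> = x then 1 else 0) - cond_mass x (past k \<omega>)) \<in>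
            borel_measurable past_events"
          by (intro borel_measurable_diff measurable_fun_past measurable_compose[OF X])
        then show ?thesis
          by (simp only: enat enat.case False if_False)
      qed (simp add: enat)
    qed simp
  qed
  also have "(\<lambda>\<omega>. (\<lambda>i \<omega>. case i of
        enat t \<Rightarrow> if t = 0 then 0 else (if X (- int t) \<omega> = x then 1 else 0) - cond_mass x (past k \<omega>)
      | \<infinity> \<Rightarrow> 0) (recurrence_time (path \<omega>) k j) \<omega>) = (\<lambda>\<omega>. sample_error x k j (path \<omega>))"
    using pos by (fastforce simp: sample_error_def fun_eq_iff split: enat.split)
  finally show ?thesis .
qed

lemma sample_error_0:
  "sample_error x k 0 w = (if w 0 = x then 1 else 0) - cond_mass x (block k w 0)"
  by (simp add: sample_error_def zero_enat_def)

text \<open>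
  The block that is current at the \<open>i\<close>-th recurrence is the original one, so the centring
  \<open>cond_mass\<close> is the same from both points of view.
\<close>

lemma sample_error_shift:
  assumes "recurrence_time w k i = enat s"
  shows "sample_error x k (i + l) w = sample_error x k l (path_shift (- int s) w)"
proof -
  have "block k w (- int s) = block k w 0"
    using assms by (simp add: recurrence_time_eq_iff)
  moreover have "path_shift (- int s) w (- int t) = w (- int t - int s)" for t
    by (simp add: path_shift_def)
  ultimately show ?thesis
    using recurrence_time_add[OF assms, of l]
    by (cases "recurrence_time (path_shift (- int s) w) k l")
      (simp_all add: sample_error_def algebra_simps)
qed

text \<open>
  After moving the origin to the \<open>i\<close>-th recurrence, the error at the earlier time is \<open>W\<close>, a function of
  the past with values in \<open>[-1, 1]\<close>, and the error at the origin is \<open>1{X\<^sub>0 = x} - p\<^sub>k(x)\<close>.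
  Conditioning on the past replaces the latter by \<open>p(x) - p\<^sub>k(x)\<close>.
\<close>

lemma correlation_le_past_gap:
  assumes "0 < l"
  shows "expectation (\<lambda>\<omega>. sample_error x k i (path \<omega>) * sample_error x k (i + l) (path \<omega>)) \<le>
         past_gap k x"
proof -
  let ?W = "\<lambda>\<omega>. sample_error x k l (path \<omega>)"
  let ?I = "indicator {\<omega> \<in> space M. X 0 \<omega> = x} :: 'w \<Rightarrow> real"
  define V where "V w = sample_error x k 0 w * sample_error x k l w" for w
  have [measurable]: "V \<in> borel_measurable paths"
    unfolding V_def by measurable
  have W [measurable]: "?W \<in> borel_measurable past_events"
    by (rule measurable_sample_error_past[OF assms])
  have V_bound: "\<bar>V w\<bar> \<le> 1" for w
    unfolding V_def abs_mult using sample_error_bound by (intro mult_le_one) auto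
  have int_c: "integrable M (\<lambda>\<omega>. ?W \<omega> * cond_mass x (past k \<omega>))"
    by (rule integrable_bounded[of _ 1])
      (auto simp: abs_mult intro!: mult_le_one sample_error_bound)
  have int_I: "integrable M (\<lambda>\<omega>. ?W \<omega> * ?I \<omega>)"
    by (rule integrable_bounded[of _ 1])
      (auto simp: abs_mult indicator_def intro!: mult_le_one sample_error_bound)
  have "expectation (\<lambda>\<omega>. sample_error x k i (path \<omega>) * sample_error x k (i + l) (path \<omega>)) =
        expectation (\<lambda>\<omega>. V (path_shift (- int (the_enat (recurrence_time (path \<omega>) k i))) (path \<omega>)))"
  proof (rule integral_cong_AE)
    show "(\<lambda>\<omega>. V (path_shift (- int (the_enat (recurrence_time (path \<omega>) k i))) (path \<omega>))) \<in>
        borel_measurable M"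
      by (rule measurable_compose_countable[where f =
            "\<lambda>t \<omega>. V (path_shift (- int (the_enat t)) (path \<omega>))"]) measurable
    show "AE \<omega> in M. sample_error x k i (path \<omega>) * sample_error x k (i + l) (path \<omega>) =
        V (path_shift (- int (the_enat (recurrence_time (path \<omega>) k i))) (path \<omega>))"
      using AE_recurrence_time_finite[of k i]
    proof eventually_elim
      case (elim \<omega>)
      then obtain s where s: "recurrence_time (path \<omega>) k i = enat s" by auto
      show ?case
        using sample_error_shift[OF s, of x l] sample_error_shift[OF s, of x 0]
        by (simp add: s V_def)
    qed
  qed measurable
  also have "\<dots> = expectation (\<lambda>\<omega>. V (path \<omega>))"
    by (rule expectation_at_recurrence[of V 1]) (auto intro: V_bound)
  also have "\<dots> = expectation (\<lambda>\<omega>. ?W \<omega> * ?I \<omega> - ?W \<omega> * cond_mass x (past k \<omega>))"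
    by (rule Bochner_Integration.integral_cong)
      (auto simp: V_def sample_error_0 indicator_def algebra_simps)
  also have "\<dots> = expectation (\<lambda>\<omega>. ?W \<omega> * ?I \<omega>) - expectation (\<lambda>\<omega>. ?W \<omega> * cond_mass x (past k \<omega>))"
    using int_I int_c by (rule Bochner_Integration.integral_diff)
  also have "expectation (\<lambda>\<omega>. ?W \<omega> * ?I \<omega>) = expectation (\<lambda>\<omega>. ?W \<omega> * cond_prob x \<omega>)"
    by (rule expectation_cond_prob(2)[where C = 1, symmetric]) (auto intro: sample_error_bound)
  also have "\<dots> - expectation (\<lambda>\<omega>. ?W \<omega> * cond_mass x (past k \<omega>)) =
      expectation (\<lambda>\<omega>. ?W \<omega> * cond_prob x \<omega> - ?W \<omega> * cond_mass x (past k \<omega>))"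
    by (rule Bochner_Integration.integral_diff[symmetric, OF _ int_c])
      (rule expectation_cond_prob(1)[where C = 1], auto intro: sample_error_bound)
  also have "\<dots> \<le> past_gap k x"
    unfolding past_gap_def
  proof (rule integral_mono)
    show "integrable M (\<lambda>\<omega>. ?W \<omega> * cond_prob x \<omega> - ?W \<omega> * cond_mass x (past k \<omega>))"
      by (intro Bochner_Integration.integrable_diff int_c expectation_cond_prob(1)[where C = 1])
        (auto intro: sample_error_bound)
    fix \<omega>
    have "?W \<omega> * (cond_prob x \<omega> - cond_mass x (past k \<omega>)) \<le>
          \<bar>?W \<omega>\<bar> * \<bar>cond_prob x \<omega> - cond_mass x (past k \<omega>)\<bar>"
      by (metis abs_ge_self abs_mult)
    also have "\<dots> \<le> 1 * \<bar>cond_prob x \<omega> - cond_mass x (past k \<omega>)\<bar>"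
      by (intro mult_right_mono sample_error_bound) auto
    finally show "?W \<omega> * cond_prob x \<omega> - ?W \<omega> * cond_mass x (past k \<omega>) \<le>
        \<bar>cond_prob x \<omega> - cond_mass x (past k \<omega>)\<bar>"
      by (simp add: right_diff_distrib)
  qed auto
  finally show ?thesis .
qed

lemma integrable_sample_error_mult:
  "integrable M (\<lambda>\<omega>. sample_error x k i (path \<omega>) * sample_error x k j (path \<omega>))"
proof (rule integrable_bounded[of _ 1])
  show "\<bar>sample_error x k i (path \<omega>) * sample_error x k j (path \<omega>)\<bar> \<le> 1" for \<omega>
    unfolding abs_mult by (intro mult_le_one sample_error_bound abs_ge_zero)
qed measurable

lemma mean_square_sample_error_le:
  assumes "0 < J"
  shows "expectation (\<lambda>\<omega>. ((\<Sum>j = 1..J. sample_error x k j (path \<omega>)) / real J)\<^sup>2) \<le>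
         1 / real J + past_gap k x"
proof -
  let ?e = "\<lambda>j \<omega>. sample_error x k j (path \<omega>)"
  have pair: "expectation (\<lambda>\<omega>. ?e i \<omega> * ?e j \<omega>) \<le> (if i = j then 1 else 0) + past_gap k x" for i j
  proof (cases i j rule: linorder_cases)
    case less
    then show ?thesis
      using correlation_le_past_gap[of "j - i" x k i] by simp
  next
    case equal
    have "expectation (\<lambda>\<omega>. ?e i \<omega> * ?e i \<omega>) \<le> expectation (\<lambda>\<omega>. 1)"
    proof (rule integral_mono[OF integrable_sample_error_mult])
      fix \<omega>
      have "\<bar>?e i \<omega> * ?e i \<omega>\<bar> \<le> 1"
        unfolding abs_mult by (intro mult_le_one sample_error_bound) auto
      then show "?e i \<omega> * ?e i \<omega> \<le> 1" by simp
    qed simp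
    then show ?thesis
      using equal past_gap_nonneg[of k x] by (simp add: prob_space)
  next
    case greater
    then show ?thesis
      using correlation_le_past_gap[of "i - j" x k j] by (simp add: mult.commute)
  qed
  have "expectation (\<lambda>\<omega>. ((\<Sum>j = 1..J. ?e j \<omega>) / real J)\<^sup>2) =
        expectation (\<lambda>\<omega>. (\<Sum>i = 1..J. \<Sum>j = 1..J. ?e i \<omega> * ?e j \<omega>) / (real J)\<^sup>2)"
    by (simp add: power_divide power2_eq_square sum_product)
  also have "\<dots> = (\<Sum>i = 1..J. \<Sum>j = 1..J. expectation (\<lambda>\<omega>. ?e i \<omega> * ?e j \<omega>)) / (real J)\<^sup>2"
    by (simp add: Bochner_Integration.integral_sum integrable_sample_error_mult)
  also have "\<dots> \<le> (\<Sum>i = 1..J. \<Sum>j = 1..J. (if i = j then 1 else 0) + past_gap k x) / (real J)\<^sup>2"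
    by (intro divide_right_mono sum_mono pair) auto
  also have "\<dots> = (real J + (real J)\<^sup>2 * past_gap k x) / (real J)\<^sup>2"
    by (rule arg_cong[where f = "\<lambda>r. r / (real J)\<^sup>2"])
      (simp add: sum.distrib power2_eq_square distrib_left)
  also have "\<dots> = 1 / real J + past_gap k x"
  proof -
    have "(r + r\<^sup>2 * g) / r\<^sup>2 = 1 / r + g" if "r > 0" for r g :: real
      using that by (simp add: field_simps power2_eq_square)
    then show ?thesis
      using assms of_nat_0_less_iff by blast
  qed
  finally show ?thesis .
qed

lemma expectation_abs_le_sqrt:
  assumes [measurable]: "f \<in> borel_measurable M" and bound: "\<And>\<omega>. \<omega> \<in> space M \<Longrightarrow> \<bar>f \<omega>\<bar> \<le> C"
  shows "expectation (\<lambda>\<omega>. \<bar>f \<omega>\<bar>) \<le> sqrt (expectation (\<lambda>\<omega>. (f \<omega>)\<^sup>2))"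
proof (rule real_le_rsqrt)
  have int: "integrable M (\<lambda>\<omega>. \<bar>f \<omega>\<bar>)"
    by (rule integrable_bounded[of _ C]) (auto intro: bound)
  have int2: "integrable M (\<lambda>\<omega>. \<bar>f \<omega>\<bar>\<^sup>2)"
    by (rule integrable_bounded[of _ "C\<^sup>2"]) (auto intro: abs_le_square_iff[THEN iffD1] order_trans[OF bound abs_ge_self])
  show "(expectation (\<lambda>\<omega>. \<bar>f \<omega>\<bar>))\<^sup>2 \<le> expectation (\<lambda>\<omega>. (f \<omega>)\<^sup>2)"
    using variance_eq[OF int int2] variance_positive[of "\<lambda>\<omega>. \<bar>f \<omega>\<bar>"] by simp
qed

lemma measurable_block_estimate [measurable]:
  "(\<lambda>\<omega>. block_estimate J (path \<omega>) k x) \<in> borel_measurable M"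
proof -
  have [measurable]: "(\<lambda>\<omega>. if path \<omega> (- int (the_enat (recurrence_time (path \<omega>) k j))) = x then 1 else 0 :: real)
      \<in> borel_measurable M" for j
  proof (rule measurable_compose_countable[where f =
        "\<lambda>t \<omega>. if path \<omega> (- int (the_enat t)) = x then 1 else 0 :: real"])
    show "(\<lambda>\<omega>. if path \<omega> (- int (the_enat t)) = x then 1 else 0 :: real) \<in> borel_measurable M" for t
      using pred_X_eq[of "- int (the_enat t)" x] by simp
  qed measurable
  show ?thesis
    unfolding block_estimate_def by measurable
qed

lemma block_estimate_bounds: "0 \<le> block_estimate J w k x" "block_estimate J w k x \<le> 1"
proof -
  have "(\<Sum>j = 1..J k. if w (- int (the_enat (recurrence_time w k j))) = x then 1 else 0 :: real) \<le>
        (\<Sum>j = 1..J k. 1)"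
    by (intro sum_mono) auto
  then show "block_estimate J w k x \<le> 1"
    by (auto simp: block_estimate_def divide_le_eq_1)
  show "0 \<le> block_estimate J w k x"
    by (auto simp: block_estimate_def intro!: sum_nonneg divide_nonneg_nonneg)
qed

lemma expectation_block_estimate_error_le:
  assumes "0 < J k"
  shows "expectation (\<lambda>\<omega>. \<bar>block_estimate J (path \<omega>) k x - cond_mass x (past k \<omega>)\<bar>) \<le>
         sqrt (1 / real (J k) + past_gap k x)"
proof -
  let ?d = "\<lambda>\<omega>. block_estimate J (path \<omega>) k x - cond_mass x (past k \<omega>)"
  let ?m = "\<lambda>\<omega>. (\<Sum>j = 1..J k. sample_error x k j (path \<omega>)) / real (J k)"
  have d_bound: "\<bar>?d \<omega>\<bar> \<le> 1" for \<omega>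
    using block_estimate_bounds[of J "path \<omega>" k x] cond_mass_nonneg[of x "past k \<omega>"]
      cond_mass_le_1[of x "past k \<omega>"] unfolding abs_le_iff by linarith
  have "AE \<omega> in M. \<forall>j\<in>{1..J k}. recurrence_time (path \<omega>) k j \<noteq> \<infinity>"
    by (intro AE_finite_allI AE_recurrence_time_finite) simp
  then have AE: "AE \<omega> in M. ?d \<omega> = ?m \<omega>"
  proof eventually_elim
    case (elim \<omega>)
    have "(\<Sum>j = 1..J k. sample_error x k j (path \<omega>)) =
          (\<Sum>j = 1..J k. (if path \<omega> (- int (the_enat (recurrence_time (path \<omega>) k j))) = x then 1 else 0) -
            cond_mass x (past k \<omega>))"
    proof (rule sum.cong)
      fix j assume "j \<in> {1..J k}"
      with elim have "recurrence_time (path \<omega>) k j \<noteq> \<infinity>" by (rule bspec)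
      then obtain t where "recurrence_time (path \<omega>) k j = enat t" by auto
      then show "sample_error x k j (path \<omega>) =
          (if path \<omega> (- int (the_enat (recurrence_time (path \<omega>) k j))) = x then 1 else 0) -
            cond_mass x (past k \<omega>)"
        by (simp add: sample_error_def)
    qed simp
    then show ?case
      using assms by (simp add: block_estimate_def sum_subtractf field_simps)
  qed
  have [measurable]: "?d \<in> borel_measurable M" by measurable
  have "expectation (\<lambda>\<omega>. \<bar>?d \<omega>\<bar>) \<le> sqrt (expectation (\<lambda>\<omega>. (?d \<omega>)\<^sup>2))"
    by (rule expectation_abs_le_sqrt[where C = 1]) (auto intro: d_bound)
  also have "expectation (\<lambda>\<omega>. (?d \<omega>)\<^sup>2) = expectation (\<lambda>\<omega>. (?m \<omega>)\<^sup>2)"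
    using AE by (intro integral_cong_AE) (measurable, auto)
  also have "sqrt \<dots> \<le> sqrt (1 / real (J k) + past_gap k x)"
    using mean_square_sample_error_le[OF assms] by (rule real_sqrt_le_mono)
  finally show ?thesis .
qed

section \<open>Affinity with the uniform distribution\<close>

text \<open>
  The Hellinger affinity between the law of a block of length \<open>k\<close> and the uniform law on \<open>S\<^sup>k\<close>.
\<close>

definition affinity :: "nat \<Rightarrow> real" where
  "affinity k = (\<Sum>b\<in>blocks k. sqrt (block_prob b / real (card S) ^ k))"

text \<open>
  If \<open>J |S|\<^sup>k = O(n)\<close>, the probability that the past ends with \<open>b\<close> and the default value is used
  is at most a constant times the weight of \<open>b\<close> in this sum, so the sum controls the error that the default causes.
\<close>

definition weighted_deviation :: "nat \<Rightarrow> 'a \<Rightarrow> real" where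
  "weighted_deviation k x =
     (\<Sum>b\<in>blocks k. sqrt (block_prob b / real (card S) ^ k) * \<bar>cond_mass x b - 1 / real (card S)\<bar>)"

lemma S_nonempty: "0 < card S"
proof -
  obtain \<omega> where "\<omega> \<in> space M"
    using not_empty by blast
  then have "S \<noteq> {}"
    using X_in_S by blast
  then show ?thesis
    using finite_S by (simp add: card_gt_0_iff)
qed

lemma sum_blocks_Suc:
  "(\<Sum>c\<in>blocks (Suc k). f c) = (\<Sum>b\<in>blocks k. \<Sum>x\<in>S. f (b @ [x]))"
proof -
  have "blocks (Suc k) = (\<lambda>(b, x). b @ [x]) ` (blocks k \<times> S)"
  proof (intro set_eqI iffI)
    fix c assume "c \<in> blocks (Suc k)"
    then show "c \<in> (\<lambda>(b, x). b @ [x]) ` (blocks k \<times> S)"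
      by (cases c rule: rev_cases) (auto simp: blocks_def)
  qed (auto simp: blocks_def)
  moreover have "inj_on (\<lambda>(b, x). b @ [x]) (blocks k \<times> S)"
    by (auto simp: inj_on_def)
  ultimately show ?thesis
    by (simp add: sum.reindex sum.cartesian_product case_prod_unfold)
qed

lemma sum_block_prob_snoc: "(\<Sum>x\<in>S. block_prob (b @ [x])) = block_prob b"
proof -
  let ?E = "\<lambda>x. {\<omega> \<in> space M. past (length b) \<omega> = b \<and> X 0 \<omega> = x}"
  have "{\<omega> \<in> space M. past (length b) \<omega> = b} = (\<Union>x\<in>S. ?E x)"
    using X_in_S by auto
  moreover have "prob (\<Union>x\<in>S. ?E x) = (\<Sum>x\<in>S. prob (?E x))"
  proof (rule finite_measure_finite_Union[OF finite_S])
    have "?E x = {\<omega> \<in> space M. past (length b) \<omega> = b} \<inter> {\<omega> \<in> space M. X 0 \<omega> = x}" for x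
      by auto
    then show "?E ` S \<subseteq> events"
      by auto
  qed (auto simp: disjoint_family_on_def)
  ultimately show ?thesis
    by (simp add: block_prob_snoc block_prob_def[of b])
qed

lemma sum_cond_mass: "block_prob b \<noteq> 0 \<Longrightarrow> (\<Sum>x\<in>S. cond_mass x b) = 1"
  by (simp add: cond_mass_def sum_block_prob_snoc flip: sum_divide_distrib)

text \<open>
  Since both \<open>p\<close> and the uniform distribution sum to 1, the bracket is a squared Hellinger
  distance, \<open>(1/2) \<Sum>\<^sub>y (sqrt (p y) - sqrt q)\<^sup>2\<close> with \<open>q = 1 / card A\<close>.  A
  single term of it dominates \<open>|p x - q|\<^sup>2\<close> because
  \<open>p x - q = (sqrt (p x) - sqrt q) (sqrt (p x) + sqrt q)\<close> and the last factor is at most 2.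
\<close>

lemma square_deviation_le:
  fixes p :: "'b \<Rightarrow> real"
  assumes "finite A" "x \<in> A" "\<And>y. y \<in> A \<Longrightarrow> 0 \<le> p y" "(\<Sum>y\<in>A. p y) = 1"
  shows "\<bar>p x - 1 / real (card A)\<bar>\<^sup>2 \<le> 8 * (1 - (\<Sum>y\<in>A. sqrt (p y / real (card A))))"
proof -
  define q where "q = 1 / real (card A)"
  have A: "card A > 0"
    using assms(1,2) by (auto simp: card_gt_0_iff)
  then have q: "0 \<le> q" "q \<le> 1" "(\<Sum>y\<in>A. q) = 1"
    by (auto simp: q_def)
  have "p x \<le> 1"
    using member_le_sum[of x A p] assms by auto
  then have "(sqrt (p x) + sqrt q)\<^sup>2 \<le> 2\<^sup>2"
    using assms q by (intro power_mono) (auto intro: order_trans[OF add_mono[of _ 1 _ 1]])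
  moreover have "p x - q = (sqrt (p x) - sqrt q) * (sqrt (p x) + sqrt q)"
    using assms q by (simp add: algebra_simps)
  ultimately have "\<bar>p x - q\<bar>\<^sup>2 \<le> (sqrt (p x) - sqrt q)\<^sup>2 * 2\<^sup>2"
    by (simp add: power_mult_distrib mult_left_mono)
  also have "(sqrt (p x) - sqrt q)\<^sup>2 \<le> (\<Sum>y\<in>A. (sqrt (p y) - sqrt q)\<^sup>2)"
    using assms by (intro member_le_sum) auto
  also have "(\<Sum>y\<in>A. (sqrt (p y) - sqrt q)\<^sup>2) = (\<Sum>y\<in>A. p y + q - 2 * sqrt (p y / real (card A)))"
    using assms(3) q(1)
    by (intro sum.cong) (auto simp: power2_diff q_def real_sqrt_divide power_divide)
  also have "\<dots> = 2 - 2 * (\<Sum>y\<in>A. sqrt (p y / real (card A)))"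
    using assms(4) q(3) by (simp add: sum.distrib sum_subtractf sum_distrib_left)
  finally show ?thesis
    by (simp add: q_def)
qed

text \<open>
  Prolonging a block \<open>b\<close> by one symbol \<open>x\<close> multiplies its weight by
  \<open>sqrt (cond_mass x b / card S)\<close>.
\<close>

lemma affinity_diff:
  "affinity k - affinity (Suc k) =
   (\<Sum>b\<in>blocks k. sqrt (block_prob b / real (card S) ^ k) *
      (1 - (\<Sum>x\<in>S. sqrt (cond_mass x b / real (card S)))))"
proof -
  have "affinity (Suc k) = (\<Sum>b\<in>blocks k. \<Sum>x\<in>S. sqrt (block_prob (b @ [x]) / real (card S) ^ Suc k))"
    unfolding affinity_def by (rule sum_blocks_Suc)
  also have "\<dots> = (\<Sum>b\<in>blocks k. \<Sum>x\<in>S. sqrt (block_prob b / real (card S) ^ k) *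
      sqrt (cond_mass x b / real (card S)))"
    by (intro sum.cong refl)
      (simp add: block_prob_mult_cond_mass[symmetric] mult.commute flip: real_sqrt_mult)
  finally show ?thesis
    by (simp add: affinity_def sum_distrib_left right_diff_distrib sum_subtractf)
qed

lemma sum_weighted_square_deviation_le:
  assumes "x \<in> S"
  shows "(\<Sum>b\<in>blocks k. sqrt (block_prob b / real (card S) ^ k) *
            \<bar>cond_mass x b - 1 / real (card S)\<bar>\<^sup>2) \<le> 8 * (affinity k - affinity (Suc k))"
  unfolding affinity_diff sum_distrib_left
proof (rule sum_mono)
  fix b
  show "sqrt (block_prob b / real (card S) ^ k) * \<bar>cond_mass x b - 1 / real (card S)\<bar>\<^sup>2 \<le>
      8 * (sqrt (block_prob b / real (card S) ^ k) *
        (1 - (\<Sum>x\<in>S. sqrt (cond_mass x b / real (card S)))))"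
  proof (cases "block_prob b = 0")
    case False
    have "\<bar>cond_mass x b - 1 / real (card S)\<bar>\<^sup>2 \<le>
          8 * (1 - (\<Sum>x\<in>S. sqrt (cond_mass x b / real (card S))))"
      using sum_cond_mass[OF False] assms finite_S
      by (intro square_deviation_le) auto
    then have "sqrt (block_prob b / real (card S) ^ k) * \<bar>cond_mass x b - 1 / real (card S)\<bar>\<^sup>2 \<le>
        sqrt (block_prob b / real (card S) ^ k) *
        (8 * (1 - (\<Sum>x\<in>S. sqrt (cond_mass x b / real (card S)))))"
      by (intro mult_left_mono) auto
    then show ?thesis by (simp only: mult_ac)
  qed simp
qed

lemma affinity_nonneg: "0 \<le> affinity k"
  by (auto simp: affinity_def intro!: sum_nonneg)

lemma affinity_Suc_le: "affinity (Suc k) \<le> affinity k"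
proof -
  obtain x where "x \<in> S"
    using S_nonempty by (metis card.empty ex_in_conv less_irrefl)
  have "0 \<le> (\<Sum>b\<in>blocks k. sqrt (block_prob b / real (card S) ^ k) *
            \<bar>cond_mass x b - 1 / real (card S)\<bar>\<^sup>2)"
    by (intro sum_nonneg) auto
  then show ?thesis
    using sum_weighted_square_deviation_le[OF \<open>x \<in> S\<close>, of k] by simp
qed

lemma affinity_le_1: "affinity k \<le> 1"
proof (induction k)
  case 0
  have "blocks 0 = {[]}"
    by (auto simp: blocks_def)
  then show ?case
    by (simp add: affinity_def block_prob_def)
next
  case (Suc k)
  then show ?case
    using affinity_Suc_le[of k] by simp
qed

lemma affinity_diff_tendsto_0: "(\<lambda>k. affinity k - affinity (Suc k)) \<longlonglongrightarrow> 0"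
proof -
  have "decseq affinity"
    using affinity_Suc_le by (rule decseq_SucI)
  then obtain L where L: "affinity \<longlonglongrightarrow> L"
    using decseq_convergent[of affinity 0] affinity_nonneg by metis
  show ?thesis
    using tendsto_diff[OF L LIMSEQ_Suc[OF L]] by simp
qed

lemma weighted_deviation_nonneg: "0 \<le> weighted_deviation k x"
  by (auto simp: weighted_deviation_def intro!: sum_nonneg mult_nonneg_nonneg)

lemma weighted_deviation_tendsto_0:
  assumes "x \<in> S"
  shows "(\<lambda>k. weighted_deviation k x) \<longlonglongrightarrow> 0"
proof -
  have le: "weighted_deviation k x \<le> sqrt (8 * (affinity k - affinity (Suc k)))" for k
  proof (rule real_le_rsqrt)
    let ?r = "\<lambda>b. sqrt (block_prob b / real (card S) ^ k)"
    let ?a = "\<lambda>b. \<bar>cond_mass x b - 1 / real (card S)\<bar>"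
    have r: "0 \<le> ?r b" for b by simp
    \<comment> \<open>Cauchy-Schwarz, with one square root of the weight in each factor.\<close>
    have "(weighted_deviation k x)\<^sup>2 = (\<Sum>b\<in>blocks k. sqrt (?r b) * (sqrt (?r b) * ?a b))\<^sup>2"
      unfolding weighted_deviation_def mult.assoc[symmetric] real_sqrt_mult_self abs_of_nonneg[OF r] ..
    also have "\<dots> \<le> (\<Sum>b\<in>blocks k. (sqrt (?r b))\<^sup>2) * (\<Sum>b\<in>blocks k. (sqrt (?r b) * ?a b)\<^sup>2)"
      by (rule Cauchy_Schwarz_ineq_sum)
    also have "\<dots> = affinity k * (\<Sum>b\<in>blocks k. ?r b * (?a b)\<^sup>2)"
      unfolding power_mult_distrib real_sqrt_pow2[OF r] affinity_def ..
    also have "\<dots> \<le> 1 * (8 * (affinity k - affinity (Suc k)))"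
      using affinity_nonneg affinity_le_1
      by (intro mult_mono sum_weighted_square_deviation_le[OF assms]) (auto intro!: sum_nonneg mult_nonneg_nonneg)
    finally show "(weighted_deviation k x)\<^sup>2 \<le> 8 * (affinity k - affinity (Suc k))" by simp
  qed
  have "(\<lambda>k. sqrt (8 * (affinity k - affinity (Suc k)))) \<longlonglongrightarrow> sqrt (8 * 0)"
    by (intro tendsto_real_sqrt tendsto_mult tendsto_const affinity_diff_tendsto_0)
  then have "(\<lambda>k. sqrt (8 * (affinity k - affinity (Suc k)))) \<longlonglongrightarrow> 0"
    by simp
  then show ?thesis
    by (rule tendsto_sandwich[OF _ _ tendsto_const, rotated 2])
      (use le weighted_deviation_nonneg in auto)
qed

section \<open>Consistency\<close>

lemma past_length_le_iff:
  "k \<le> n \<Longrightarrow> past_length J w k \<le> enat n \<longleftrightarrow> recurrence_time w k (J k) \<le> enat (n - k)"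
  by (cases "recurrence_time w k (J k)") (auto simp: past_length_def)

text \<open>
  The probability that \<open>b\<close> is current and recurs too late is at most \<open>block_prob b\<close> and, by the bound on
  late recurrences, at most \<open>C / |S|\<^sup>k\<close>; hence it is at most the geometric mean of the two.
\<close>

lemma expectation_default_error_le:
  assumes kn: "k \<le> n" and C: "real (J k) * real (card S) ^ k \<le> C * (real (n - k) + 1)"
  shows "expectation (\<lambda>\<omega>. \<bar>1 / real (card S) - cond_mass x (past k \<omega>)\<bar> *
            indicator {\<omega> \<in> space M. \<not> past_length J (path \<omega>) k \<le> enat n} \<omega>) \<le>
         sqrt C * weighted_deviation k x"
proof -
  let ?L = "{\<omega> \<in> space M. \<not> past_length J (path \<omega>) k \<le> enat n}"
  let ?N = "real (card S) ^ k"
  have N: "?N > 0" using S_nonempty by simp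
  have [measurable]: "?L \<in> events"
    unfolding past_length_le_iff[OF kn] by measurable
  have tail: "prob {\<omega> \<in> ?L. past k \<omega> = b} \<le> sqrt C * sqrt (block_prob b / ?N)" if "b \<in> blocks k" for b
  proof -
    let ?p = "prob {\<omega> \<in> ?L. past k \<omega> = b}"
    have "?p \<le> prob {\<omega> \<in> space M. past k \<omega> = b}"
      by (rule finite_measure_mono) auto
    then have 1: "?p \<le> block_prob b"
      using that by (simp add: block_prob_def blocks_def)
    have eq: "{\<omega> \<in> ?L. past k \<omega> = b} =
        {\<omega> \<in> space M. past k \<omega> = b \<and> \<not> recurrence_time (path \<omega>) k (J k) \<le> enat (n - k)}"
      using past_length_le_iff[OF kn] by auto
    have "?p \<le> real (J k) / (real (n - k) + 1)"
      unfolding eq by (rule late_recurrence_prob_le)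
    also have "\<dots> \<le> C / ?N"
      using C N by (simp add: field_simps)
    finally have 2: "?p \<le> C / ?N" .
    have "?p * ?p \<le> block_prob b * (C / ?N)"
      using 1 2 by (intro mult_mono) auto
    then have "?p \<le> sqrt (block_prob b * (C / ?N))"
      by (intro real_le_rsqrt) (simp add: power2_eq_square)
    then show ?thesis
      by (simp add: real_sqrt_mult[symmetric] mult.commute)
  qed
  have "expectation (\<lambda>\<omega>. \<bar>1 / real (card S) - cond_mass x (past k \<omega>)\<bar> * indicator ?L \<omega>) =
        (\<Sum>b\<in>blocks k. \<bar>1 / real (card S) - cond_mass x b\<bar> * prob {\<omega> \<in> ?L. past k \<omega> = b})"
    using expectation_fun_past_mult_indicator[of ?L "\<lambda>b. \<bar>1 / real (card S) - cond_mass x b\<bar>" k] by simp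
  also have "\<dots> \<le> (\<Sum>b\<in>blocks k. \<bar>1 / real (card S) - cond_mass x b\<bar> *
      (sqrt C * sqrt (block_prob b / ?N)))"
    by (intro sum_mono mult_left_mono tail) auto
  also have "\<dots> = sqrt C * weighted_deviation k x"
    unfolding weighted_deviation_def sum_distrib_left
    by (intro sum.cong) (simp_all add: mult_ac abs_minus_commute)
  finally show ?thesis .
qed

lemma measurable_truncated_estimate [measurable]:
  "(\<lambda>\<omega>. truncated_estimate J k Q (path \<omega>) n x) \<in> borel_measurable M"
proof -
  have [measurable]: "Measurable.pred M (\<lambda>\<omega>. past_length J (path \<omega>) (k n) \<le> enat n)"
    unfolding past_length_def by measurable
  show ?thesis
    unfolding truncated_estimate_def by measurable
qed

lemma integrable_truncated_estimate:
  "integrable M (\<lambda>\<omega>. truncated_estimate J k Q (path \<omega>) n x)"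
proof (rule integrable_bounded[of _ "1 + \<bar>Q x\<bar>"])
  show "\<bar>truncated_estimate J k Q (path \<omega>) n x\<bar> \<le> 1 + \<bar>Q x\<bar>" for \<omega>
    using block_estimate_bounds[of J "path \<omega>" "k n" x]
    by (auto simp: truncated_estimate_def intro: order_trans[of _ 1])
qed measurable

lemma expectation_truncated_error_le:
  assumes kn: "k n \<le> n" and J: "0 < J (k n)"
    and C: "real (J (k n)) * real (card S) ^ k n \<le> C * (real (n - k n) + 1)"
  shows "expectation (\<lambda>\<omega>. \<bar>truncated_estimate J k (\<lambda>_. 1 / real (card S)) (path \<omega>) n x - cond_prob x \<omega>\<bar>) \<le>
         sqrt (1 / real (J (k n)) + past_gap (k n) x) + sqrt C * weighted_deviation (k n) x +
         past_gap (k n) x"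
proof -
  let ?k = "k n"
  let ?L = "{\<omega> \<in> space M. \<not> past_length J (path \<omega>) ?k \<le> enat n}"
  let ?c = "\<lambda>\<omega>. cond_mass x (past ?k \<omega>)"
  let ?f = "\<lambda>\<omega>. \<bar>block_estimate J (path \<omega>) ?k x - ?c \<omega>\<bar>"
  let ?g = "\<lambda>\<omega>. \<bar>1 / real (card S) - ?c \<omega>\<bar> * indicator ?L \<omega>"
  let ?h = "\<lambda>\<omega>. \<bar>cond_prob x \<omega> - ?c \<omega>\<bar>"
  have [measurable]: "?L \<in> events"
    unfolding past_length_le_iff[OF kn] by measurable
  have f: "integrable M ?f"
  proof (rule integrable_bounded[of _ 1])
    show "\<bar>?f \<omega>\<bar> \<le> 1" for \<omega>
      using block_estimate_bounds[of J "path \<omega>" ?k x] cond_mass_nonneg[of x "past ?k \<omega>"]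
        cond_mass_le_1[of x "past ?k \<omega>"] unfolding abs_abs abs_le_iff by linarith
  qed measurable
  have g: "integrable M ?g"
    using integrable_fun_past_mult_indicator[of ?L "\<lambda>b. \<bar>1 / real (card S) - cond_mass x b\<bar>" ?k] by simp
  have h: "integrable M ?h"
    by auto
  have "expectation (\<lambda>\<omega>. \<bar>truncated_estimate J k (\<lambda>_. 1 / real (card S)) (path \<omega>) n x - cond_prob x \<omega>\<bar>) \<le>
        expectation (\<lambda>\<omega>. ?f \<omega> + ?g \<omega> + ?h \<omega>)"
  proof (rule integral_mono)
    fix \<omega> assume "\<omega> \<in> space M"
    then show "\<bar>truncated_estimate J k (\<lambda>_. 1 / real (card S)) (path \<omega>) n x - cond_prob x \<omega>\<bar> \<le>
        ?f \<omega> + ?g \<omega> + ?h \<omega>"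
      by (auto simp: truncated_estimate_def indicator_def)
  qed (use f g h in \<open>auto intro!: integrable_abs Bochner_Integration.integrable_diff integrable_truncated_estimate\<close>)
  also have "\<dots> = expectation ?f + expectation ?g + expectation ?h"
    using f g h by simp
  also have "\<dots> \<le> sqrt (1 / real (J ?k) + past_gap ?k x) + sqrt C * weighted_deviation ?k x + past_gap ?k x"
    unfolding past_gap_def[symmetric]
    by (intro add_mono order_refl expectation_block_estimate_error_le expectation_default_error_le J kn C)
  finally show ?thesis .
qed

text \<open>
  The hypothesis \<open>J |S|\<^sup>k = O(n)\<close> enters through the late recurrences.  As \<open>J\<close> tends to infinity and
  \<open>k \<le> |S|\<^sup>k\<close>, it also forces \<open>2 k \<le> n\<close> eventually, so that \<open>n - k + 1\<close>, the room left for
  recurrences, is still of order \<open>n\<close>.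
\<close>

theorem truncated_estimates_consistent:
  assumes card: "card S \<ge> 2" and k: "filterlim k at_top sequentially"
    and J: "filterlim (\<lambda>n. J (k n)) at_top sequentially"
    and O: "(\<lambda>n. real (J (k n)) * real (card S) ^ k n) \<in> O(\<lambda>n. real n)"
  shows "consistent_in_mean M S X J k"
proof -
  obtain c where c: "c > 0" "\<forall>\<^sub>F n in sequentially. real (J (k n)) * real (card S) ^ k n \<le> c * real n"
    using landau_o.bigE[OF O] by auto
  have large: "\<forall>\<^sub>F n in sequentially. k n \<le> n \<and> 0 < J (k n) \<and>
      real (J (k n)) * real (card S) ^ k n \<le> 2 * c * (real (n - k n) + 1)"
  proof -
    have "\<forall>\<^sub>F n in sequentially. nat \<lceil>2 * c\<rceil> + 1 \<le> J (k n)"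
      using J by (simp add: filterlim_at_top)
    with c(2) show ?thesis
    proof eventually_elim
      case (elim n)
      \<comment> \<open>Once \<open>J \<ge> 2 c\<close>, the growth condition yields \<open>2 c k \<le> J |S|\<^sup>k \<le> c n\<close>.\<close>
      have "real (k n) \<le> 2 ^ k n"
        using of_nat_less_two_power[of "k n", where 'a = real] by simp
      also have "\<dots> \<le> real (card S) ^ k n"
        using card by (intro power_mono) auto
      finally have "2 * c * real (k n) \<le> real (J (k n)) * real (card S) ^ k n"
        using elim(2) c(1) by (intro mult_mono) linarith+
      also have "\<dots> \<le> c * real n"
        by (rule elim)
      finally have half: "2 * real (k n) \<le> real n"
        using c(1) by simp
      then have kn: "k n \<le> n" by linarith
      have "real n \<le> 2 * (real (n - k n) + 1)"
        using half kn by (simp add: of_nat_diff)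
      then have "c * real n \<le> c * (2 * (real (n - k n) + 1))"
        using c(1) by (intro mult_left_mono) auto
      then show ?case
        using elim kn by (auto simp: algebra_simps)
    qed
  qed
  have gap: "(\<lambda>n. past_gap (k n) x) \<longlonglongrightarrow> 0" for x
    using filterlim_compose[OF past_gap_tendsto_0 k] .
  have J0: "(\<lambda>n. 1 / real (J (k n))) \<longlonglongrightarrow> 0"
    using filterlim_compose[OF lim_1_over_n J] .
  have "(\<lambda>n. expectation (\<lambda>\<omega>. \<bar>truncated_estimate J k (\<lambda>_. 1 / real (card S)) (path \<omega>) n x - cond_prob x \<omega>\<bar>)) \<longlonglongrightarrow> 0"
    if x: "x \<in> S" for x
  proof (rule tendsto_sandwich[OF _ _ tendsto_const])
    have "(\<lambda>n. sqrt (1 / real (J (k n)) + past_gap (k n) x) + sqrt (2 * c) * weighted_deviation (k n) x +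
         past_gap (k n) x) \<longlonglongrightarrow> sqrt (0 + 0) + sqrt (2 * c) * 0 + 0"
      by (intro tendsto_add tendsto_real_sqrt tendsto_mult tendsto_const J0 gap
          filterlim_compose[OF weighted_deviation_tendsto_0[OF x] k])
    then show "(\<lambda>n. sqrt (1 / real (J (k n)) + past_gap (k n) x) + sqrt (2 * c) * weighted_deviation (k n) x +
         past_gap (k n) x) \<longlonglongrightarrow> 0"
      by simp
    show "\<forall>\<^sub>F n in sequentially.
        expectation (\<lambda>\<omega>. \<bar>truncated_estimate J k (\<lambda>_. 1 / real (card S)) (path \<omega>) n x - cond_prob x \<omega>\<bar>) \<le>
        sqrt (1 / real (J (k n)) + past_gap (k n) x) + sqrt (2 * c) * weighted_deviation (k n) x +
        past_gap (k n) x"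
      using large by eventually_elim (rule expectation_truncated_error_le, auto)
  qed auto
  then show ?thesis
    unfolding consistent_in_mean_def tendsto_L1_def
    using integrable_truncated_estimate integrable_cond_prob by (simp add: path_def)
qed

end

text \<open>
  With \<open>k \<le> (1 - \<epsilon>) log\<^sub>N n\<close> the product \<open>J N\<^sup>k\<close> is at most
  \<open>N powr (k * \<epsilon> / (1 - \<epsilon>) + k) = N powr (k / (1 - \<epsilon>)) \<le> n\<close>.
\<close>

lemma power_rate_params:
  fixes N :: nat and \<epsilon> :: real
  assumes N: "N \<ge> 2" and \<epsilon>: "0 < \<epsilon>" "\<epsilon> < 1"
  defines "J \<equiv> \<lambda>i. nat \<lfloor>real N powr (real i * \<epsilon> / (1 - \<epsilon>))\<rfloor>"
    and "k \<equiv> \<lambda>n. max 1 (nat \<lfloor>(1 - \<epsilon>) * log (real N) (real n)\<rfloor>)"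
  shows "filterlim k at_top sequentially"
    and "filterlim (\<lambda>n. J (k n)) at_top sequentially"
    and "(\<lambda>n. real (J (k n)) * real N ^ k n) \<in> O(\<lambda>n. real n)"
proof -
  have pos: "0 < ln (real N)"
    using N by simp
  have "filterlim (\<lambda>n. (1 - \<epsilon>) / ln (real N) * ln (real n)) at_top sequentially"
    using pos \<epsilon> by (intro filterlim_tendsto_pos_mult_at_top[OF tendsto_const]
        filterlim_compose[OF ln_at_top filterlim_real_sequentially]) auto
  then have log_lim: "filterlim (\<lambda>n. (1 - \<epsilon>) * log (real N) (real n)) at_top sequentially"
    by (simp add: log_def)
  have "filterlim (\<lambda>n. nat \<lfloor>(1 - \<epsilon>) * log (real N) (real n)\<rfloor>) at_top sequentially"
    using filterlim_compose[OF filterlim_nat_sequentially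
        filterlim_compose[OF filterlim_floor_sequentially log_lim]] .
  then show k_lim: "filterlim k at_top sequentially"
    by (rule filterlim_at_top_mono) (auto simp: k_def)
  have "filterlim (\<lambda>i. \<epsilon> / (1 - \<epsilon>) * ln (real N) * real i) at_top sequentially"
    using pos \<epsilon> by (intro filterlim_tendsto_pos_mult_at_top[OF tendsto_const]
        filterlim_real_sequentially) auto
  from filterlim_compose[OF exp_at_top this]
  have "filterlim (\<lambda>i. real N powr (real i * \<epsilon> / (1 - \<epsilon>))) at_top sequentially"
    using N by (simp add: powr_def mult_ac)
  then have "filterlim J at_top sequentially"
    unfolding J_def using filterlim_compose[OF filterlim_nat_sequentially
        filterlim_compose[OF filterlim_floor_sequentially]] by blast
  from filterlim_compose[OF this k_lim]
  show "filterlim (\<lambda>n. J (k n)) at_top sequentially" .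
  have "\<forall>\<^sub>F n in sequentially. 1 \<le> (1 - \<epsilon>) * log (real N) (real n)"
    using log_lim by (simp add: filterlim_at_top)
  with eventually_gt_at_top[of 0]
  have "\<forall>\<^sub>F n in sequentially. real (J (k n)) * real N ^ k n \<le> real n"
  proof eventually_elim
    case (elim n)
    have k_le: "real (k n) \<le> (1 - \<epsilon>) * log (real N) (real n)"
      using elim(2) unfolding k_def by linarith
    have "real (J (k n)) \<le> real N powr (real (k n) * \<epsilon> / (1 - \<epsilon>))"
      unfolding J_def by (simp add: of_nat_nat)
    moreover have "real N ^ k n = real N powr real (k n)"
      using N by (simp add: powr_realpow)
    ultimately have "real (J (k n)) * real N ^ k n \<le>
        real N powr (real (k n) * \<epsilon> / (1 - \<epsilon>)) * real N powr real (k n)"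
      by (simp add: mult_right_mono)
    also have "\<dots> = real N powr (real (k n) / (1 - \<epsilon>))"
      using \<epsilon> by (simp add: field_simps flip: powr_add)
    also have "\<dots> \<le> real N powr log (real N) (real n)"
      using k_le N \<epsilon> by (intro powr_mono) (auto simp: field_simps)
    also have "\<dots> = real n"
      using elim(1) N by simp
    finally show ?case .
  qed
  then show "(\<lambda>n. real (J (k n)) * real N ^ k n) \<in> O(\<lambda>n. real n)"
    by (intro landau_o.bigI[of 1]) auto
qed

theorem theorem3:
  fixes M :: "'w measure" and S :: "'a set" and X :: "int \<Rightarrow> 'w \<Rightarrow> 'a"
  assumes "prob_space M"
    and "finite S" and "card S \<ge> 2"
    and "stationary_process M (count_space S) X"
  shows
    "(\<forall>J k :: nat \<Rightarrow> nat.
        (\<forall>i\<ge>1. J i \<ge> 1) \<and> mono_on {1..} J \<and>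
        (\<forall>n\<ge>1. k n \<ge> 1) \<and> mono_on {1..} k \<and>
        filterlim k at_top sequentially \<and>
        filterlim (\<lambda>n. J (k n)) at_top sequentially \<and>
        (\<lambda>n. real (J (k n)) * real (card S) ^ k n) \<in> O(\<lambda>n. real n)
        \<longrightarrow> consistent_in_mean M S X J k) \<and>
     (\<forall>\<epsilon>::real. 0 < \<epsilon> \<and> \<epsilon> < 1 \<longrightarrow>
        consistent_in_mean M S X
          (\<lambda>i. nat \<lfloor>real (card S) powr (real i * \<epsilon> / (1 - \<epsilon>))\<rfloor>)
          (\<lambda>n. max 1 (nat \<lfloor>(1 - \<epsilon>) * log (real (card S)) (real n)\<rfloor>)))"
proof -
  interpret prob_space M by fact
  interpret finite_stationary_process M S X
    by unfold_locales fact+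
  show ?thesis
  proof (intro conjI allI impI)
    fix J k :: "nat \<Rightarrow> nat"
    assume "(\<forall>i\<ge>1. J i \<ge> 1) \<and> mono_on {1..} J \<and>
        (\<forall>n\<ge>1. k n \<ge> 1) \<and> mono_on {1..} k \<and>
        filterlim k at_top sequentially \<and>
        filterlim (\<lambda>n. J (k n)) at_top sequentially \<and>
        (\<lambda>n. real (J (k n)) * real (card S) ^ k n) \<in> O(\<lambda>n. real n)"
    then show "consistent_in_mean M S X J k"
      by (intro truncated_estimates_consistent[OF assms(3)]) simp_all
  next
    fix \<epsilon> :: real
    assume "0 < \<epsilon> \<and> \<epsilon> < 1"
    then show "consistent_in_mean M S X
          (\<lambda>i. nat \<lfloor>real (card S) powr (real i * \<epsilon> / (1 - \<epsilon>))\<rfloor>)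
          (\<lambda>n. max 1 (nat \<lfloor>(1 - \<epsilon>) * log (real (card S)) (real n)\<rfloor>))"
      by (intro truncated_estimates_consistent[OF assms(3)] power_rate_params[OF assms(3)]) simp_all
  qed
qed

end
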